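(* Let $X\subseteq\{0,1\}^{\mathbb Z}$ be a measure-theoretically subordinate subshift with base measure $\nu$ such that $h(\nu)=0$. Then $h_{top}(X)=\nu(1)$. Moreover, $X$ is intrinsically ergodic and its unique measure of maximal entropy is $M_*(\nu\otimes B_{1/2})$.
   Context: $\sigma$ is the left shift on $\{0,1\}^{\mathbb Z}$; $\mathcal M(Y)$ is the set of shift-invariant Borel probability measures on $Y$; $\nu(1)=\nu(\{x:x_0=1\})$; entropies use logarithm base 2. $B_{1/2}$ is the $(1/2,1/2)$ Bernoulli measure on $\{0,1\}^{\mathbb Z}$. $M(x,y)=x\cdot y$ coordinatewise, $\pi_1$ the first-coordinate projection. A subshift $X$ is a measure-theoretically subordinate subshift with base measure $\nu$ if $\mathcal M(X)=\{M_*(\lambda):\lambda\in\mathcal M((\{0,1\}^{\mathbb Z})^2,\sigma^{\times2}),(\pi_1)_*\lambda=\nu\}$. Intrinsically ergodic means there is exactly one invariant measure of maximal entropy. *)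

theory Defs
  imports "HOL-Probability.Probability"
begin

type_synonym config = "int \<Rightarrow> bool"

text \<open>The full shift {0,1}^Z as a measurable space (product sigma-algebra = Borel sigma-algebra
 of the product topology, since the space is compact metrizable).  True encodes the symbol 1.\<close>
definition Omega :: "config measure" where
  "Omega = PiM UNIV (\<lambda>_::int. count_space (UNIV::bool set))"

definition shift :: "config \<Rightarrow> config" where
  "shift x = (\<lambda>i. x (i + 1))"

text \<open>Closedness in the product topology, written out via cylinders.\<close>
definition shift_closed :: "config set \<Rightarrow> bool" where
  "shift_closed X \<longleftrightarrow>
     (\<forall>x. (\<forall>n::nat. \<exists>y\<in>X. \<forall>i::int. \<bar>i\<bar> \<le> int n \<longrightarrow> y i = x i) \<longrightarrow> x \<in> X)"

definition subshift :: "config set \<Rightarrow> bool" where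
  "subshift X \<longleftrightarrow> shift_closed X \<and> shift ` X = X"

definition inv_meas :: "config set \<Rightarrow> config measure set" where
  "inv_meas Y = {\<mu>. sets \<mu> = sets Omega \<and> prob_space \<mu> \<and> distr \<mu> Omega shift = \<mu>
                     \<and> emeasure \<mu> Y = 1}"

definition inv_meas2 :: "(config \<times> config) measure set" where
  "inv_meas2 = {L. sets L = sets (Omega \<Otimes>\<^sub>M Omega) \<and> prob_space L
                     \<and> distr L (Omega \<Otimes>\<^sub>M Omega) (map_prod shift shift) = L}"

definition Mult :: "config \<times> config \<Rightarrow> config" where
  "Mult p = (\<lambda>i. fst p i \<and> snd p i)"

definition meas_subordinate :: "config set \<Rightarrow> config measure \<Rightarrow> bool" where
  "meas_subordinate X \<nu> \<longleftrightarrow>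
     subshift X \<and>
     inv_meas X = {distr L Omega Mult | L. L \<in> inv_meas2 \<and> distr L Omega fst = \<nu>}"

definition cyl :: "bool list \<Rightarrow> config set" where
  "cyl w = {x. \<forall>i<length w. x (int i) = w ! i}"

definition block_entropy :: "config measure \<Rightarrow> nat \<Rightarrow> real" where
  "block_entropy \<mu> n =
     - (\<Sum>w\<in>{w::bool list. length w = n}. measure \<mu> (cyl w) * log 2 (measure \<mu> (cyl w)))"

text \<open>Kolmogorov-Sinai entropy of a shift-invariant measure (base 2), computed with the
  generating time-zero partition.\<close>
definition ent :: "config measure \<Rightarrow> real" where
  "ent \<mu> = lim (\<lambda>n. block_entropy \<mu> n / real n)"

definition words :: "config set \<Rightarrow> nat \<Rightarrow> bool list set" where
  "words X n = (\<lambda>x. map (\<lambda>i. x (int i)) [0..<n]) ` X"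

definition htop :: "config set \<Rightarrow> real" where
  "htop X = lim (\<lambda>n. log 2 (real (card (words X n))) / real n)"

definition mme :: "config set \<Rightarrow> config measure \<Rightarrow> bool" where
  "mme X \<mu> \<longleftrightarrow> \<mu> \<in> inv_meas X \<and> (\<forall>L\<in>inv_meas X. ent L \<le> ent \<mu>)"

definition intrinsically_ergodic :: "config set \<Rightarrow> bool" where
  "intrinsically_ergodic X \<longleftrightarrow> (\<exists>!\<mu>. mme X \<mu>)"

definition Bernoulli_half :: "config measure" where
  "Bernoulli_half = PiM UNIV (\<lambda>_::int. measure_pmf (bernoulli_pmf (1/2)))"

end

theory Submission
  imports Defs "HOL-Library.Nat_Bijection"
begin

text \<open>
For a joining of \<open>\<nu>\<close> with coordinates \<open>(x, y)\<close> and \<open>z = x \<cdot> y\<close>, the entropy of the \<open>n\<close>-word of \<open>z\<close>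
given that of \<open>x\<close> is at most the expected number of ones of \<open>x\<close>, that is \<open>n \<nu>(1)\<close>, with
equality iff \<open>z\<close> is conditionally uniform below \<open>x\<close>. As \<open>h(\<nu>) = 0\<close>, this gives \<open>h(z) \<le> \<nu>(1)\<close>. If
\<open>h(z) = \<nu>(1)\<close>, subadditivity of the conditional entropy forces equality for every word length, which
determines the law of \<open>z\<close>; the product with the Bernoulli measure attains it.

For \<open>h\<^sub>t\<^sub>o\<^sub>p(X) \<le> \<nu>(1)\<close>, a weak limit \<open>\<mu> \<in> M(X)\<close> of empirical measures is compared with its Markov
approximations: coding the words of \<open>X\<close> by the order-\<open>k\<close> approximation shows that their growth rate is at
most \<open>H\<^sub>k\<^sub>+\<^sub>1(\<mu>) - H\<^sub>k(\<mu>)\<close> for every \<open>k\<close>, hence at most \<open>h(\<mu>)\<close>.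
\<close>

section \<open>Entropy of stationary word functions\<close>

text \<open>Entropy estimates are made for functions on finite words: \<open>ent\<close> depends on
  nothing else, and an invariant measure is determined by its word probabilities. Conditional
  entropy is handled as a difference of two word entropies, so no conditional measures occur. The
  recurring tool is Gibbs' inequality: the law at hand is compared with a suitably chosen
  sub-probability, and the equality case yields uniqueness. A joining is recorded through (x, z) and
  not (x, y), because \<open>Mult\<close> forgets y wherever x is 0; only then is the maximum one
  bit for each 1 of x. The product attains the bound because H(x) + n \<nu>(1) = H(x, z) \<le> H(x)
  + H(z), where H(x) cancels. The obstacle in the topological half is that the entropy of a weak
  limit need not be the limit of the entropies. For a fixed order k only finitely many cylinders
  matter, and their probabilities do converge; k varies only after the limit has been taken. The
  limit measure itself is produced on the real line, through a Cantor code whose decoding is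
  continuous.\<close>

lemma gibbs_term:
  fixes p q :: real
  assumes "0 \<le> p" "0 \<le> q" "p > 0 \<Longrightarrow> q > 0"
  shows "p * (log 2 q - log 2 p) \<le> (q - p) / ln 2"
    and "p * (log 2 q - log 2 p) = (q - p) / ln 2 \<Longrightarrow> p = q"
proof -
  have *: "p * (log 2 q - log 2 p) = p * ln (q / p) / ln 2" if "p > 0"
    using that assms(3)[OF that] by (simp add: log_def ln_div diff_divide_distrib right_diff_distrib)
  have le: "p * ln (q / p) \<le> q - p" if "p > 0"
  proof -
    have "p * ln (q / p) \<le> p * (q / p - 1)"
      using that assms(3)[OF that] by (intro mult_left_mono ln_le_minus_one) auto
    then show ?thesis using that by (simp add: right_diff_distrib)
  qed
  show "p * (log 2 q - log 2 p) \<le> (q - p) / ln 2"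
  proof (cases "p > 0")
    case True
    then show ?thesis unfolding *[OF True] using le[OF True] by (intro divide_right_mono) auto
  next
    case False
    then show ?thesis using assms(1,2) by auto
  qed
  show "p = q" if eq: "p * (log 2 q - log 2 p) = (q - p) / ln 2"
  proof (cases "p > 0")
    case True
    then have "p * ln (q / p) / ln 2 = (q - p) / ln 2" using eq * by simp
    then have "p * ln (q / p) = q - p" by (simp add: divide_simps split: if_splits)
    also have "\<dots> = p * (q / p - 1)" using True by (simp add: field_simps)
    finally have "ln (q / p) = q / p - 1" using True by auto
    then have "q / p = 1"
      using ln_eq_minus_one[of "q / p"] assms(3)[OF True] True by auto
    then show ?thesis using True by auto
  next
    case False
    then show ?thesis using eq assms(1) by auto
  qed
qed

text \<open>Summing ln t \<le> t - 1 at t = q / p. Positivity of \<open>q\<close> where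
  \<open>p\<close> is positive is demanded because \<open>log 2 0 = 0\<close> would otherwise
  falsify the bound. In the equality case nonnegative slacks with total at most 0 vanish one by
  one.\<close>

lemma gibbs_inequality:
  fixes p q :: "'a \<Rightarrow> real"
  assumes "finite S" and p: "\<And>s. s \<in> S \<Longrightarrow> 0 \<le> p s" and q: "\<And>s. s \<in> S \<Longrightarrow> 0 \<le> q s"
    and pq: "\<And>s. s \<in> S \<Longrightarrow> p s > 0 \<Longrightarrow> q s > 0"
    and sp: "sum p S = 1" and sq: "sum q S \<le> 1"
  shows "(\<Sum>s\<in>S. p s * log 2 (q s)) \<le> (\<Sum>s\<in>S. p s * log 2 (p s))"
    and "(\<Sum>s\<in>S. p s * log 2 (p s)) \<le> (\<Sum>s\<in>S. p s * log 2 (q s)) \<Longrightarrow> s \<in> S \<Longrightarrow> p s = q s"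
proof -
  let ?d = "\<lambda>s. (q s - p s) / ln 2 - p s * (log 2 (q s) - log 2 (p s))"
  have d: "0 \<le> ?d s" if "s \<in> S" for s
    using gibbs_term(1)[of "p s" "q s"] p q pq that by auto
  have "(\<Sum>s\<in>S. (q s - p s) / ln 2) = (sum q S - sum p S) / ln 2"
    by (simp add: sum_divide_distrib[symmetric] sum_subtractf)
  also have "\<dots> \<le> 0" using sp sq by (simp add: divide_nonpos_pos)
  finally have le: "(\<Sum>s\<in>S. (q s - p s) / ln 2) \<le> 0" .
  have sd: "(\<Sum>s\<in>S. ?d s) = (\<Sum>s\<in>S. (q s - p s) / ln 2)
      - ((\<Sum>s\<in>S. p s * log 2 (q s)) - (\<Sum>s\<in>S. p s * log 2 (p s)))"
    by (simp add: sum_subtractf right_diff_distrib)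
  show "(\<Sum>s\<in>S. p s * log 2 (q s)) \<le> (\<Sum>s\<in>S. p s * log 2 (p s))"
    using sum_nonneg[of S ?d] d sd le by fastforce
  assume "(\<Sum>s\<in>S. p s * log 2 (p s)) \<le> (\<Sum>s\<in>S. p s * log 2 (q s))" and s: "s \<in> S"
  then have "(\<Sum>s\<in>S. ?d s) \<le> 0" using sd le by linarith
  then have "(\<Sum>s\<in>S. ?d s) = 0" using sum_nonneg[of S ?d] d by (meson order_antisym)
  then have "?d s = 0" using sum_nonneg_eq_0_iff[of S ?d] d s assms(1) by blast
  then show "p s = q s" using gibbs_term(2)[of "p s" "q s"] p q pq s by auto
qed

text \<open>The limit is the infimum of the quotients; the second conclusion keeps this, so that a
  single word length already bounds the rate.\<close>

lemma fekete:
  fixes a :: "nat \<Rightarrow> real"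
  assumes nonneg: "\<And>n. 0 \<le> a n" and sub: "\<And>m n. a (m + n) \<le> a m + a n"
  shows "\<exists>L. (\<lambda>n. a n / real n) \<longlonglongrightarrow> L \<and> (\<forall>n. real n * L \<le> a n)"
proof -
  let ?S = "(\<lambda>n. a n / real n) ` {0<..}"
  define L where "L = Inf ?S"
  have bdd: "bdd_below ?S" by (rule bdd_belowI[of _ 0]) (auto simp: nonneg)
  have lower: "L \<le> a n / real n" if "n > 0" for n
    unfolding L_def by (rule cInf_lower[OF _ bdd]) (use that in auto)
  have mult: "a (j * k + r) \<le> real j * a k + a r" for j k r
  proof (induction j)
    case (Suc j)
    have "a (Suc j * k + r) \<le> a k + a (j * k + r)"
      using sub[of k "j * k + r"] by (simp add: add.assoc)
    with Suc show ?case by (simp add: algebra_simps)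
  qed simp
  have "(\<lambda>n. a n / real n) \<longlonglongrightarrow> L"
  proof (rule LIMSEQ_I)
    fix e :: real assume e: "0 < e"
    obtain x where "x \<in> ?S" "x < L + e / 2"
      using cInf_lessD[of ?S "L + e/2"] e unfolding L_def by fastforce
    then obtain k where k: "k > 0" "a k / real k < L + e / 2" by auto
    \<comment> \<open>A bound for all remainders \<open>a (n mod k)\<close>; after division by
      \<open>n\<close> it drops below e / 2.\<close>
    define C where "C = (\<Sum>r<k. a r)"
    have C: "a r \<le> C" if "r < k" for r
      unfolding C_def using that nonneg by (intro member_le_sum) auto
    obtain N :: nat where N: "real N > 2 * C / e" using reals_Archimedean2 by blast
    show "\<exists>no. \<forall>n\<ge>no. norm (a n / real n - L) < e"
    proof (intro exI allI impI)
      fix n assume n: "n \<ge> Suc N"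
      have "a n = a (n div k * k + n mod k)" by simp
      also have "\<dots> \<le> real (n div k) * a k + a (n mod k)" by (rule mult)
      also have "\<dots> \<le> real n / real k * a k + C"
        using k C nonneg by (intro add_mono mult_right_mono) (auto simp: of_nat_div_le_of_nat)
      finally have "a n / real n \<le> (real n / real k * a k + C) / real n"
        by (intro divide_right_mono) auto
      also have "\<dots> = a k / real k + C / real n" using n by (simp add: field_simps)
      also have "C / real n < e / 2"
      proof -
        have "2 * C / e < real n" using N n by linarith
        then show ?thesis using e n by (simp add: field_simps)
      qed
      finally have "a n / real n < L + e" using k by linarith
      with lower[of n] n show "norm (a n / real n - L) < e" by auto
    qed
  qed
  moreover have "real n * L \<le> a n" for n
    using lower[of n] nonneg[of n] by (cases "n = 0") (auto simp: field_simps)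
  ultimately show ?thesis by blast
qed

section \<open>Summation over words of a fixed length\<close>

declare sum_mult_of_bool_eq [simp del] sum_of_bool_mult_eq [simp del]

definition wordsn :: "nat \<Rightarrow> 'a list set" where
  "wordsn n = {v. length v = n}"

lemma in_wordsn [simp]: "v \<in> wordsn n \<longleftrightarrow> length v = n"
  by (simp add: wordsn_def)

lemma finite_wordsn [simp]: "finite (wordsn n :: 'a::finite list set)"
  using finite_lists_length_eq[of "UNIV :: 'a set" n] by (simp add: wordsn_def)

lemma card_wordsn: "card (wordsn n :: 'a::finite list set) = CARD('a) ^ n"
  using card_lists_length_eq[of "UNIV :: 'a set" n] by (simp add: wordsn_def)

lemma wordsn_0 [simp]: "wordsn 0 = {[]}"
  by auto

lemma sum_wordsn_add:
  "(\<Sum>v\<in>wordsn (n + m). f v) = (\<Sum>v\<in>wordsn n. \<Sum>w\<in>wordsn m. f (v @ w))"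
  for f :: "'a::finite list \<Rightarrow> 'b::comm_monoid_add"
proof -
  have "bij_betw (\<lambda>(v, w). v @ w) (wordsn n \<times> wordsn m) (wordsn (n + m) :: 'a list set)"
    by (rule bij_betw_byWitness[where f' = "\<lambda>v. (take n v, drop n v)"]) auto
  then have "(\<Sum>v\<in>wordsn (n + m). f v) = (\<Sum>(v, w)\<in>wordsn n \<times> wordsn m. f (v @ w))"
    by (simp add: sum.reindex_bij_betw[symmetric] case_prod_unfold)
  then show ?thesis by (simp add: sum.cartesian_product)
qed

lemma sum_wordsn_1: "(\<Sum>v\<in>wordsn (Suc 0). f v) = (\<Sum>a\<in>UNIV. f [a])"
  for f :: "'a::finite list \<Rightarrow> 'b::comm_monoid_add"
proof -
  have "bij_betw (\<lambda>a. [a]) UNIV (wordsn (Suc 0) :: 'a list set)"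
    by (rule bij_betw_byWitness[where f' = hd]) (auto simp: length_Suc_conv)
  then show ?thesis by (simp add: sum.reindex_bij_betw[symmetric])
qed

lemma sum_wordsn_snoc:
  "(\<Sum>v\<in>wordsn (Suc n). f v) = (\<Sum>v\<in>wordsn n. \<Sum>a\<in>UNIV. f (v @ [a]))"
  for f :: "'a::finite list \<Rightarrow> 'b::comm_monoid_add"
  using sum_wordsn_add[where n = n and m = "Suc 0" and f = f] by (simp add: sum_wordsn_1)

lemma sum_wordsn_cons:
  "(\<Sum>v\<in>wordsn (Suc n). f v) = (\<Sum>a\<in>UNIV. \<Sum>v\<in>wordsn n. f (a # v))"
  for f :: "'a::finite list \<Rightarrow> 'b::comm_monoid_add"
  using sum_wordsn_add[where n = "Suc 0" and m = n and f = f] by (simp add: sum_wordsn_1)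

text \<open>Sums over the fibre of a letter map carry \<open>of_bool\<close> factors instead of
  ranging over filtered sets, which is why two simp rules are removed above: sums in this form can
  be swapped and factored, and here the indicator is collapsed again.\<close>

lemma sum_of_bool_word:
  fixes g :: "'a::finite list \<Rightarrow> real"
  assumes "length v = n"
  shows "(\<Sum>u\<in>wordsn n. of_bool (v = u) * g u) = g v"
proof -
  have "(\<Sum>u\<in>wordsn n. of_bool (v = u) * g u) = (\<Sum>u\<in>wordsn n. if v = u then g u else 0)"
    by (intro sum.cong refl) simp
  then show ?thesis using assms by simp
qed

lemma sum_swap4:
  "(\<Sum>a\<in>A. \<Sum>b\<in>B. \<Sum>c\<in>C. \<Sum>d\<in>D. h a b c d) = (\<Sum>c\<in>C. \<Sum>d\<in>D. \<Sum>a\<in>A. \<Sum>b\<in>B. h a b c d)"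
  (is "?l = _")
proof -
  have "?l = (\<Sum>a\<in>A. \<Sum>c\<in>C. \<Sum>d\<in>D. \<Sum>b\<in>B. h a b c d)"
    by (intro sum.cong refl) (subst sum.swap, intro sum.cong refl, rule sum.swap)
  also have "\<dots> = (\<Sum>c\<in>C. \<Sum>d\<in>D. \<Sum>a\<in>A. \<Sum>b\<in>B. h a b c d)"
    by (subst sum.swap, intro sum.cong refl, rule sum.swap)
  finally show ?thesis .
qed

section \<open>Stationary word laws and their factors\<close>

definition word_entropy :: "('a list \<Rightarrow> real) \<Rightarrow> nat \<Rightarrow> real" where
  "word_entropy p n = - (\<Sum>v\<in>wordsn n. p v * log 2 (p v))"

definition factor :: "('a \<Rightarrow> 'b) \<Rightarrow> ('a list \<Rightarrow> real) \<Rightarrow> 'b list \<Rightarrow> real" where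
  "factor f p u = (\<Sum>v\<in>wordsn (length u). p v * of_bool (map f v = u))"

text \<open>Change of variables: \<open>factor f p\<close> is the image of the law \<open>p\<close>
  under the letterwise map \<open>f\<close>.\<close>

lemma sum_factor:
  fixes f :: "'a::finite \<Rightarrow> 'b::finite"
  shows "(\<Sum>u\<in>wordsn n. factor f p u * g u) = (\<Sum>v\<in>wordsn n. p v * g (map f v))"
proof -
  have "(\<Sum>u\<in>wordsn n. factor f p u * g u)
      = (\<Sum>u\<in>wordsn n. \<Sum>v\<in>wordsn n. p v * (of_bool (map f v = u) * g u))"
    by (intro sum.cong refl) (simp add: factor_def sum_distrib_right mult.assoc)
  also have "\<dots> = (\<Sum>v\<in>wordsn n. p v * (\<Sum>u\<in>wordsn n. of_bool (map f v = u) * g u))"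
    by (subst sum.swap) (simp add: sum_distrib_left)
  also have "\<dots> = (\<Sum>v\<in>wordsn n. p v * g (map f v))"
    by (intro sum.cong refl) (simp add: sum_of_bool_word)
  finally show ?thesis .
qed

text \<open>The finite-dimensional laws of a stationary process: \<open>snoc\<close> is Kolmogorov
  consistency, \<open>cons\<close> is invariance under the shift.\<close>

locale stationary =
  fixes p :: "'a::finite list \<Rightarrow> real"
  assumes nonneg: "0 \<le> p v" and nil: "p [] = 1"
    and snoc: "(\<Sum>a\<in>UNIV. p (v @ [a])) = p v"
    and cons: "(\<Sum>a\<in>UNIV. p (a # v)) = p v"
begin

lemma sum_append: "(\<Sum>u\<in>wordsn k. p (v @ u)) = p v"
  by (induction k) (simp_all add: sum_wordsn_snoc snoc append_assoc[symmetric] del: append_assoc)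

lemma sum_prepend: "(\<Sum>u\<in>wordsn k. p (u @ v)) = p v"
proof (induction k)
  case (Suc k)
  have "(\<Sum>u\<in>wordsn (Suc k). p (u @ v)) = (\<Sum>u\<in>wordsn k. \<Sum>a\<in>UNIV. p (a # (u @ v)))"
    unfolding sum_wordsn_cons by (subst sum.swap) simp
  then show ?case using Suc by (simp only: cons)
qed simp

lemma sum_words: "sum p (wordsn k) = 1"
  using sum_append[where k = k and v = "[]"] by (simp add: nil)

lemma le_1: "p v \<le> 1"
  using member_le_sum[of v "wordsn (length v)" p] sum_words[of "length v"] nonneg by auto

text \<open>Carries positivity of a weight from letters of positive probability to all words of
  positive probability.\<close>

lemma le_letter: "a \<in> set v \<Longrightarrow> p v \<le> p [a]"
proof -
  assume "a \<in> set v"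
  then obtain xs ys where v: "v = xs @ a # ys" by (auto dest: split_list)
  have "p v \<le> p (a # ys)"
    unfolding v using member_le_sum[of xs "wordsn (length xs)" "\<lambda>u. p (u @ a # ys)"] nonneg
    by (auto simp: sum_prepend)
  also have "\<dots> \<le> p [a]"
    using member_le_sum[of ys "wordsn (length ys)" "\<lambda>u. p ([a] @ u)"] nonneg
    by (auto simp: sum_append simp del: append.simps) auto
  finally show ?thesis .
qed

lemma word_entropy_nonneg: "0 \<le> word_entropy p n"
proof -
  have "p v * log 2 (p v) \<le> 0" for v
    using nonneg[of v] le_1[of v] by (cases "p v = 0") (auto intro!: mult_nonneg_nonpos)
  then show ?thesis unfolding word_entropy_def by (simp add: sum_nonpos)
qed

text \<open>By stationarity every position of the word contributes the same mean.\<close>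

lemma sum_list_mean:
  fixes g :: "'a \<Rightarrow> real"
  shows "(\<Sum>v\<in>wordsn n. p v * sum_list (map g v)) = real n * (\<Sum>a\<in>UNIV. p [a] * g a)"
proof (induction n)
  case (Suc n)
  have "(\<Sum>v\<in>wordsn (Suc n). p v * sum_list (map g v))
     = (\<Sum>a\<in>UNIV. \<Sum>v\<in>wordsn n. p (a # v) * g a)
       + (\<Sum>a\<in>UNIV. \<Sum>v\<in>wordsn n. p (a # v) * sum_list (map g v))"
    by (simp add: sum_wordsn_cons distrib_left sum.distrib)
  also have "(\<Sum>a\<in>UNIV. \<Sum>v\<in>wordsn n. p (a # v) * g a) = (\<Sum>a\<in>UNIV. p [a] * g a)"
  proof (intro sum.cong refl)
    fix a
    show "(\<Sum>v\<in>wordsn n. p (a # v) * g a) = p [a] * g a"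
      using sum_append[where k = n and v = "[a]"] by (simp add: sum_distrib_right[symmetric])
  qed
  also have "(\<Sum>a\<in>UNIV. \<Sum>v\<in>wordsn n. p (a # v) * sum_list (map g v))
      = (\<Sum>v\<in>wordsn n. p v * sum_list (map g v))"
    by (subst sum.swap) (simp add: sum_distrib_right[symmetric] cons)
  finally show ?case using Suc by (simp add: algebra_simps)
qed simp

context
  fixes f :: "'a \<Rightarrow> 'b::finite"
begin

lemma factor_nonneg: "0 \<le> factor f p u"
  unfolding factor_def by (intro sum_nonneg) (auto simp: nonneg)

lemma le_factor: "p v \<le> factor f p (map f v)"
  using member_le_sum[of v "wordsn (length v)" "\<lambda>w. p w * of_bool (map f w = map f v)"] nonneg
  by (auto simp: factor_def)

lemma factor_pos: "p v > 0 \<Longrightarrow> factor f p (map f v) > 0"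
  using le_factor[of v] by linarith

lemma sum_factor_words: "(\<Sum>u\<in>wordsn n. factor f p u) = 1"
  using sum_factor[of f p "\<lambda>_. 1" n] by (simp add: sum_words)

lemma word_entropy_factor:
  "word_entropy (factor f p) n = - (\<Sum>v\<in>wordsn n. p v * log 2 (factor f p (map f v)))"
  unfolding word_entropy_def by (subst sum_factor) simp

abbreviation (input) cond :: "'a list \<Rightarrow> real" where
  "cond v \<equiv> p v / factor f p (map f v)"

text \<open>\<open>cond v\<close> is the conditional probability of \<open>v\<close> given its
  factor word. The sum is 1 unless the factor word has probability 0; then division by zero makes it
  0, hence only an inequality.\<close>

lemma sum_cond_le: "(\<Sum>v\<in>wordsn (length u). cond v * of_bool (map f v = u)) \<le> 1"
proof -
  have "(\<Sum>v\<in>wordsn (length u). cond v * of_bool (map f v = u))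
      = (\<Sum>v\<in>wordsn (length u). p v * of_bool (map f v = u) / factor f p u)"
    by (intro sum.cong refl) auto
  also have "\<dots> = factor f p u / factor f p u"
    by (simp only: sum_divide_distrib[symmetric]) (simp only: factor_def)
  also have "\<dots> \<le> 1" by simp
  finally show ?thesis .
qed

text \<open>Chain rule: up to sign, the left side is the conditional entropy of a word given its
  factor word.\<close>

lemma sum_cond:
  "(\<Sum>v\<in>wordsn n. p v * log 2 (cond v)) = word_entropy (factor f p) n - word_entropy p n"
proof -
  have "p v * log 2 (cond v) = p v * log 2 (p v) - p v * log 2 (factor f p (map f v))" for v
  proof (cases "p v > 0")
    case True
    then show ?thesis using factor_pos[OF True] by (simp add: log_divide right_diff_distrib)
  next
    case False
    then have "p v = 0" using nonneg[of v] by simp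
    then show ?thesis by simp
  qed
  then show ?thesis
    by (simp add: word_entropy_factor) (simp add: word_entropy_def sum_subtractf)
qed

lemma entropy_factor_le: "word_entropy (factor f p) n \<le> word_entropy p n"
proof -
  have "p v * log 2 (cond v) \<le> 0" for v
  proof (cases "p v > 0")
    case True
    then have "0 < cond v" "cond v \<le> 1"
      using factor_pos[OF True] le_factor[of v] by auto
    then show ?thesis using True by (intro mult_nonneg_nonpos) auto
  next
    case False
    then have "p v = 0" using nonneg[of v] by simp
    then show ?thesis by simp
  qed
  then show ?thesis using sum_cond[of n] sum_nonpos[of "wordsn n" "\<lambda>v. p v * log 2 (cond v)"] by auto
qed

text \<open>Gibbs' inequality against the law under which, given the factor word, the two
  halves are independent.\<close>
lemma cond_entropy_subadditive:
  "word_entropy p (n + m) - word_entropy (factor f p) (n + m)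
   \<le> (word_entropy p n - word_entropy (factor f p) n)
     + (word_entropy p m - word_entropy (factor f p) m)"
proof -
  let ?F = "factor f p"
  let ?q = "\<lambda>x. ?F (map f x) * (cond (take n x) * cond (drop n x))"
  have cnn: "0 \<le> cond v" for v by (simp add: nonneg factor_nonneg)
  have pos: "p (take n x) > 0 \<and> p (drop n x) > 0" if "p x > 0" for x
  proof -
    have "p x \<le> p (take n x)"
      using member_le_sum[of "drop n x" "wordsn (length (drop n x))" "\<lambda>u. p (take n x @ u)"] nonneg
      by (auto simp: sum_append simp del: length_drop)
    moreover have "p x \<le> p (drop n x)"
      using member_le_sum[of "take n x" "wordsn (length (take n x))" "\<lambda>u. p (u @ drop n x)"] nonneg
      by (auto simp: sum_prepend simp del: length_take)
    ultimately show ?thesis using that by linarith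
  qed
  \<comment> \<open>Total mass of \<open>?q\<close>: once the factor words \<open>u\<close> and
    \<open>u'\<close> of the two halves are fixed, the two conditional laws sum separately to at
    most 1.\<close>
  have "(\<Sum>x\<in>wordsn (n + m). ?q x)
      = (\<Sum>v\<in>wordsn n. \<Sum>w\<in>wordsn m. ?F (map f v @ map f w) * (cond v * cond w))"
    by (simp add: sum_wordsn_add)
  also have "\<dots> = (\<Sum>v\<in>wordsn n. \<Sum>w\<in>wordsn m. \<Sum>u\<in>wordsn n. \<Sum>u'\<in>wordsn m.
      ?F (u @ u') * ((cond v * of_bool (map f v = u)) * (cond w * of_bool (map f w = u'))))"
  proof (intro sum.cong refl)
    fix v w :: "'a list" assume vw: "v \<in> wordsn n" "w \<in> wordsn m"
    have "(\<Sum>u\<in>wordsn n. \<Sum>u'\<in>wordsn m.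
      ?F (u @ u') * ((cond v * of_bool (map f v = u)) * (cond w * of_bool (map f w = u'))))
      = (\<Sum>u\<in>wordsn n. of_bool (map f v = u) * (\<Sum>u'\<in>wordsn m.
      of_bool (map f w = u') * (?F (u @ u') * (cond v * cond w))))"
      unfolding sum_distrib_left by (intro sum.cong refl) (simp only: mult_ac)
    also have "\<dots> = ?F (map f v @ map f w) * (cond v * cond w)"
      using vw by (simp only: sum_of_bool_word in_wordsn length_map)
    finally show "?F (map f v @ map f w) * (cond v * cond w) = (\<Sum>u\<in>wordsn n. \<Sum>u'\<in>wordsn m.
      ?F (u @ u') * ((cond v * of_bool (map f v = u)) * (cond w * of_bool (map f w = u'))))" by simp
  qed
  also have "\<dots> = (\<Sum>u\<in>wordsn n. \<Sum>u'\<in>wordsn m. \<Sum>v\<in>wordsn n. \<Sum>w\<in>wordsn m.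
      ?F (u @ u') * ((cond v * of_bool (map f v = u)) * (cond w * of_bool (map f w = u'))))"
    by (rule sum_swap4)
  also have "\<dots> = (\<Sum>u\<in>wordsn n. \<Sum>u'\<in>wordsn m. ?F (u @ u') *
      ((\<Sum>v\<in>wordsn n. cond v * of_bool (map f v = u)) * (\<Sum>w\<in>wordsn m. cond w * of_bool (map f w = u'))))"
    unfolding sum_product unfolding sum_distrib_left ..
  also have "\<dots> \<le> (\<Sum>u\<in>wordsn n. \<Sum>u'\<in>wordsn m. ?F (u @ u') * (1 * 1))"
  proof (intro sum_mono mult_left_mono mult_mono factor_nonneg)
    fix u u' :: "'b list" assume "u \<in> wordsn n" "u' \<in> wordsn m"
    then show "(\<Sum>v\<in>wordsn n. cond v * of_bool (map f v = u)) \<le> 1"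
      "(\<Sum>v\<in>wordsn m. cond v * of_bool (map f v = u')) \<le> 1"
      using sum_cond_le[of u] sum_cond_le[of u'] by auto
  qed (auto intro!: sum_nonneg divide_nonneg_nonneg mult_nonneg_nonneg nonneg factor_nonneg)
  also have "\<dots> = 1" using sum_factor_words[of "n + m"] by (simp add: sum_wordsn_add)
  finally have sq: "(\<Sum>x\<in>wordsn (n + m). ?q x) \<le> 1" .
  have "(\<Sum>x\<in>wordsn (n + m). p x * log 2 (?q x)) \<le> (\<Sum>x\<in>wordsn (n + m). p x * log 2 (p x))"
  proof (rule gibbs_inequality(1)[OF finite_wordsn nonneg _ _ sum_words sq])
    show "0 \<le> ?q x" for x
      by (intro mult_nonneg_nonneg factor_nonneg cnn)
    show "?q x > 0" if "p x > 0" for x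
      using pos[OF that] that by (intro mult_pos_pos divide_pos_pos factor_pos) auto
  qed
  also have "(\<Sum>x\<in>wordsn (n + m). p x * log 2 (?q x))
     = (\<Sum>x\<in>wordsn (n + m). p x * log 2 (?F (map f x)))
       + (\<Sum>x\<in>wordsn (n + m). p x * log 2 (cond (take n x)))
       + (\<Sum>x\<in>wordsn (n + m). p x * log 2 (cond (drop n x)))"
    unfolding sum.distrib[symmetric]
  proof (intro sum.cong refl)
    fix x
    show "p x * log 2 (?q x) = p x * log 2 (?F (map f x)) + p x * log 2 (cond (take n x))
      + p x * log 2 (cond (drop n x))"
    proof (cases "p x > 0")
      case True
      then have "?F (map f x) > 0" "cond (take n x) > 0" "cond (drop n x) > 0"
        using pos by (auto intro!: divide_pos_pos factor_pos)
      then show ?thesis by (simp only: log_mult_pos mult_pos_pos distrib_left add.assoc)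
    next
      case False
      then have "p x = 0" using nonneg[of x] by simp
      then show ?thesis by simp
    qed
  qed
  also have "(\<Sum>x\<in>wordsn (n + m). p x * log 2 (?F (map f x))) = - word_entropy ?F (n + m)"
    by (simp add: word_entropy_factor)
  also have "(\<Sum>x\<in>wordsn (n + m). p x * log 2 (cond (take n x))) = (\<Sum>v\<in>wordsn n. p v * log 2 (cond v))"
    by (simp add: sum_wordsn_add sum_distrib_right[symmetric] sum_append)
  also have "(\<Sum>x\<in>wordsn (n + m). p x * log 2 (cond (drop n x))) = (\<Sum>v\<in>wordsn m. p v * log 2 (cond v))"
    by (simp add: sum_wordsn_add, subst sum.swap) (simp add: sum_distrib_right[symmetric] sum_prepend)
  finally show ?thesis unfolding sum_cond by (simp add: word_entropy_def[of p "n+m"])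
qed

lemma cond_entropy_mult:
  "word_entropy p (n * k) - word_entropy (factor f p) (n * k)
   \<le> real n * (word_entropy p k - word_entropy (factor f p) k)"
proof (induction n)
  case 0
  show ?case by (simp add: word_entropy_def factor_def nil)
next
  case (Suc n)
  then show ?case using cond_entropy_subadditive[of k "n * k"] by (simp add: algebra_simps)
qed

text \<open>Here \<open>\<kappa>\<close> is a transition probability from factor letters to letters; the
  law \<open>factor f p (map f v) * prod_list (map \<kappa> v)\<close> maximises the entropy among the
  laws with the same factor and the same expected logarithm of \<open>\<kappa>\<close>.\<close>
context
  fixes \<kappa> :: "'a \<Rightarrow> real"
  assumes \<kappa>_nonneg: "0 \<le> \<kappa> a"
    and \<kappa>_sum: "(\<Sum>a\<in>UNIV. \<kappa> a * of_bool (f a = b)) \<le> 1"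
    and \<kappa>_pos: "p [a] > 0 \<Longrightarrow> \<kappa> a > 0"
begin

text \<open>The sum over a fibre factors into one sum per letter, each at most 1.\<close>

lemma sum_kernel_le:
  "(\<Sum>v\<in>wordsn (length u). prod_list (map \<kappa> v) * of_bool (map f v = u)) \<le> 1"
proof (induction u)
  case (Cons b u)
  have "(\<Sum>v\<in>wordsn (length (b # u)). prod_list (map \<kappa> v) * of_bool (map f v = b # u))
     = (\<Sum>a\<in>UNIV. \<kappa> a * of_bool (f a = b))
       * (\<Sum>v\<in>wordsn (length u). prod_list (map \<kappa> v) * of_bool (map f v = u))"
    by (simp add: sum_wordsn_cons sum_product) (intro sum.cong refl; simp)
  also have "\<dots> \<le> 1 * 1"
    by (intro mult_mono Cons \<kappa>_sum)
       (auto intro!: sum_nonneg mult_nonneg_nonneg prod_list_nonneg simp: \<kappa>_nonneg)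
  finally show ?case by simp
qed simp

text \<open>Gibbs' inequality against \<open>?q\<close>. Apart from the entropy of the factor, the
  cross entropy depends only on the one-letter marginals of \<open>p\<close>, hence is linear in
  \<open>n\<close>. The three claims are the bound, the law forced by equality, and the fact that
  this law attains it.\<close>

lemma entropy_le_kernel:
  shows "word_entropy p n \<le> word_entropy (factor f p) n - real n * (\<Sum>a\<in>UNIV. p [a] * log 2 (\<kappa> a))"
    and "word_entropy (factor f p) n - real n * (\<Sum>a\<in>UNIV. p [a] * log 2 (\<kappa> a)) \<le> word_entropy p n
      \<Longrightarrow> length v = n \<Longrightarrow> p v = factor f p (map f v) * prod_list (map \<kappa> v)"
    and "(\<And>v. p v = factor f p (map f v) * prod_list (map \<kappa> v)) \<Longrightarrow>
      word_entropy p n = word_entropy (factor f p) n - real n * (\<Sum>a\<in>UNIV. p [a] * log 2 (\<kappa> a))"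
proof -
  let ?q = "\<lambda>v. factor f p (map f v) * prod_list (map \<kappa> v)"
  have knn: "0 \<le> prod_list (map \<kappa> v)" for v
    by (intro prod_list_nonneg) (auto simp: \<kappa>_nonneg)
  have all_pos: "\<kappa> a > 0" if "p v > 0" "a \<in> set v" for a v
    using le_letter[OF that(2)] that(1) by (intro \<kappa>_pos) linarith
  have kpos: "prod_list (map \<kappa> v) > 0 \<and> log 2 (prod_list (map \<kappa> v)) = sum_list (map (\<lambda>a. log 2 (\<kappa> a)) v)"
    if "\<And>a. a \<in> set v \<Longrightarrow> \<kappa> a > 0" for v
    using that
  proof (induction v)
    case (Cons a v)
    then have "\<kappa> a > 0" "prod_list (map \<kappa> v) > 0"
      "log 2 (prod_list (map \<kappa> v)) = sum_list (map (\<lambda>a. log 2 (\<kappa> a)) v)" by auto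
    then show ?case by (simp add: log_mult)
  qed simp
  have "(\<Sum>v\<in>wordsn n. ?q v)
      = (\<Sum>v\<in>wordsn n. \<Sum>u\<in>wordsn n. factor f p u * (prod_list (map \<kappa> v) * of_bool (map f v = u)))"
  proof (intro sum.cong refl)
    fix v :: "'a list" assume v: "v \<in> wordsn n"
    have "(\<Sum>u\<in>wordsn n. factor f p u * (prod_list (map \<kappa> v) * of_bool (map f v = u)))
       = (\<Sum>u\<in>wordsn n. of_bool (map f v = u) * (factor f p u * prod_list (map \<kappa> v)))"
      by (intro sum.cong refl) (simp only: mult_ac)
    also have "\<dots> = ?q v"
      using v by (simp only: sum_of_bool_word in_wordsn length_map)
    finally show "?q v = (\<Sum>u\<in>wordsn n. factor f p u * (prod_list (map \<kappa> v) * of_bool (map f v = u)))"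
      by simp
  qed
  also have "\<dots> = (\<Sum>u\<in>wordsn n. factor f p u * (\<Sum>v\<in>wordsn n. prod_list (map \<kappa> v) * of_bool (map f v = u)))"
    by (subst sum.swap) (simp add: sum_distrib_left)
  also have "\<dots> \<le> (\<Sum>u\<in>wordsn n. factor f p u * 1)"
    by (intro sum_mono mult_left_mono factor_nonneg) (use sum_kernel_le in auto)
  also have "\<dots> = 1" by (simp add: sum_factor_words)
  finally have sq: "(\<Sum>v\<in>wordsn n. ?q v) \<le> 1" .
  have qpos: "?q v > 0" if "p v > 0" for v
    using kpos[of v] all_pos[OF that] factor_pos[OF that] by simp
  have "(\<Sum>v\<in>wordsn n. p v * log 2 (?q v))
     = (\<Sum>v\<in>wordsn n. p v * log 2 (factor f p (map f v)))
       + (\<Sum>v\<in>wordsn n. p v * sum_list (map (\<lambda>a. log 2 (\<kappa> a)) v))"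
    unfolding sum.distrib[symmetric]
  proof (intro sum.cong refl)
    fix v
    show "p v * log 2 (?q v) = p v * log 2 (factor f p (map f v))
      + p v * sum_list (map (\<lambda>a. log 2 (\<kappa> a)) v)"
    proof (cases "p v > 0")
      case True
      then show ?thesis using kpos[of v] all_pos[OF True] factor_pos[OF True]
        by (simp add: log_mult distrib_left)
    next
      case False
      then have "p v = 0" using nonneg[of v] by simp
      then show ?thesis by simp
    qed
  qed
  then have eq: "(\<Sum>v\<in>wordsn n. p v * log 2 (?q v))
     = - word_entropy (factor f p) n + real n * (\<Sum>a\<in>UNIV. p [a] * log 2 (\<kappa> a))"
    by (simp add: word_entropy_factor sum_list_mean)
  have nn: "0 \<le> ?q v" for v using knn factor_nonneg by simp
  note g = gibbs_inequality[of "wordsn n" p ?q, OF finite_wordsn nonneg nn qpos sum_words sq, unfolded eq]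
  show "word_entropy p n \<le> word_entropy (factor f p) n - real n * (\<Sum>a\<in>UNIV. p [a] * log 2 (\<kappa> a))"
    using g(1) unfolding word_entropy_def[of p] by linarith
  show "p v = ?q v" if "word_entropy (factor f p) n - real n * (\<Sum>a\<in>UNIV. p [a] * log 2 (\<kappa> a)) \<le> word_entropy p n"
    "length v = n"
    using g(2)[of v] that unfolding word_entropy_def[of p] by simp
  show "word_entropy p n = word_entropy (factor f p) n - real n * (\<Sum>a\<in>UNIV. p [a] * log 2 (\<kappa> a))"
    if "\<And>v. p v = ?q v"
    using eq unfolding that[symmetric] word_entropy_def[of p] by linarith
qed

end

text \<open>Gibbs' inequality against the product of the two image laws. By injectivity a word is
  recovered from its two image words, so that this product has mass at most 1.\<close>

lemma entropy_le_factors: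
  fixes g :: "'a \<Rightarrow> 'c::finite"
  assumes inj: "inj (\<lambda>a. (f a, g a))"
  shows "word_entropy p n \<le> word_entropy (factor f p) n + word_entropy (factor g p) n"
proof -
  let ?q = "\<lambda>v. factor f p (map f v) * factor g p (map g v)"
  have gnn: "0 \<le> factor g p u" for u
    unfolding factor_def by (intro sum_nonneg) (auto simp: nonneg)
  have gsum: "(\<Sum>u\<in>wordsn n. factor g p u) = 1"
    using sum_factor[of g p "\<lambda>_. 1" n] by (simp add: sum_words)
  have gpos: "factor g p (map g v) > 0" if "p v > 0" for v
    using member_le_sum[of v "wordsn (length v)" "\<lambda>w. p w * of_bool (map g w = map g v)"] nonneg that
    by (auto simp: factor_def)
  have "inj_on (\<lambda>v. (map f v, map g v)) (wordsn n)"
  proof (rule inj_onI)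
    fix v w :: "'a list" assume vw: "v \<in> wordsn n" "w \<in> wordsn n" "(map f v, map g v) = (map f w, map g w)"
    show "v = w"
    proof (rule nth_equalityI)
      fix i assume i: "i < length v"
      have "map f v ! i = map f w ! i" "map g v ! i = map g w ! i" using vw by auto
      then show "v ! i = w ! i" using i vw injD[OF inj, of "v ! i" "w ! i"] by auto
    qed (use vw in auto)
  qed
  then have "(\<Sum>v\<in>wordsn n. ?q v)
      = (\<Sum>(u, u')\<in>(\<lambda>v. (map f v, map g v)) ` wordsn n. factor f p u * factor g p u')"
    by (subst sum.reindex) auto
  also have "\<dots> \<le> (\<Sum>(u, u')\<in>wordsn n \<times> wordsn n. factor f p u * factor g p u')"
    by (intro sum_mono2) (auto simp: factor_nonneg gnn)
  also have "\<dots> = (\<Sum>u\<in>wordsn n. factor f p u) * (\<Sum>u\<in>wordsn n. factor g p u)"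
    by (simp add: sum_product sum.cartesian_product)
  also have "\<dots> = 1" by (simp add: sum_factor_words gsum)
  finally have sq: "(\<Sum>v\<in>wordsn n. ?q v) \<le> 1" .
  have "(\<Sum>v\<in>wordsn n. p v * log 2 (?q v)) \<le> (\<Sum>v\<in>wordsn n. p v * log 2 (p v))"
    by (rule gibbs_inequality(1)[OF _ _ _ _ sum_words sq]) (auto simp: nonneg factor_nonneg gnn factor_pos gpos)
  also have "(\<Sum>v\<in>wordsn n. p v * log 2 (?q v)) = (\<Sum>v\<in>wordsn n. p v * log 2 (factor f p (map f v)))
       + (\<Sum>v\<in>wordsn n. p v * log 2 (factor g p (map g v)))"
    unfolding sum.distrib[symmetric]
  proof (intro sum.cong refl)
    fix v
    show "p v * log 2 (?q v) = p v * log 2 (factor f p (map f v)) + p v * log 2 (factor g p (map g v))"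
    proof (cases "p v > 0")
      case True
      then show ?thesis using factor_pos[OF True] gpos[OF True] by (simp add: log_mult distrib_left)
    next
      case False
      then have "p v = 0" using nonneg[of v] by simp
      then show ?thesis by simp
    qed
  qed
  finally show ?thesis
    unfolding word_entropy_def by (simp add: sum_factor)
qed

end

text \<open>The conditional statement for the factor onto a one-letter alphabet, whose entropy is
  0.\<close>

lemma word_entropy_subadditive: "word_entropy p (n + m) \<le> word_entropy p n + word_entropy p m"
proof -
  have "factor (\<lambda>_. ()) p u = (\<Sum>v\<in>wordsn (length u). p v)" for u
    unfolding factor_def by (intro sum.cong refl) (simp add: list_eq_iff_nth_eq)
  then have "factor (\<lambda>_. ()) p u = 1" for u
    by (simp add: sum_words)
  then have "word_entropy (factor (\<lambda>_. ()) p) k = 0" for k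
    by (simp add: word_entropy_def)
  then show ?thesis using cond_entropy_subadditive[where f = "\<lambda>_. ()" and n = n and m = m] by simp
qed

lemma entropy_rate:
  obtains h where "(\<lambda>n. word_entropy p n / real n) \<longlonglongrightarrow> h" "\<And>n. real n * h \<le> word_entropy p n"
  using fekete[OF word_entropy_nonneg word_entropy_subadditive] by blast

end

text \<open>The summand is the probability that a Markov chain of order \<open>k\<close> with transition
  probabilities \<open>q\<close> assigns to \<open>v\<close> given its first \<open>k\<close> letters.\<close>
lemma sum_markov_le:
  fixes q :: "'a::finite list \<Rightarrow> real"
  assumes q: "\<And>v. 0 \<le> q v" and sum: "\<And>v. length v = k \<Longrightarrow> (\<Sum>a\<in>UNIV. q (v @ [a])) \<le> 1"
  shows "(\<Sum>v\<in>wordsn n. \<Prod>j<n - k. q (take (Suc k) (drop j v))) \<le> real (CARD('a) ^ k)"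
proof (induction n)
  case (Suc n)
  show ?case
  proof (cases "n < k")
    \<comment> \<open>No transition fits into a word of length at most \<open>k\<close>: the product
      is empty and the sum counts words, which is the origin of the bound.\<close>
    case True
    then have "CARD('a) ^ Suc n \<le> CARD('a) ^ k" by (intro power_increasing) auto
    then show ?thesis using True by (simp add: card_wordsn del: power_Suc of_nat_power)
  next
    case False
    have "(\<Prod>j<Suc n - k. q (take (Suc k) (drop j (v @ [a]))))
       = (\<Prod>j<n - k. q (take (Suc k) (drop j v))) * q (drop (n - k) v @ [a])" if v: "length v = n" for v a
    proof -
      have "(\<Prod>j<Suc n - k. q (take (Suc k) (drop j (v @ [a]))))
       = (\<Prod>j<n - k. q (take (Suc k) (drop j (v @ [a])))) * q (take (Suc k) (drop (n - k) (v @ [a])))"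
        using False by (simp add: Suc_diff_le)
      also have "take (Suc k) (drop (n - k) (v @ [a])) = drop (n - k) v @ [a]" using v False by simp
      also have "(\<Prod>j<n - k. q (take (Suc k) (drop j (v @ [a])))) = (\<Prod>j<n - k. q (take (Suc k) (drop j v)))"
        using v by (intro prod.cong refl) auto
      finally show ?thesis .
    qed
    then have "(\<Sum>v\<in>wordsn (Suc n). \<Prod>j<Suc n - k. q (take (Suc k) (drop j v)))
      = (\<Sum>v\<in>wordsn n. (\<Prod>j<n - k. q (take (Suc k) (drop j v))) * (\<Sum>a\<in>UNIV. q (drop (n - k) v @ [a])))"
      by (simp add: sum_wordsn_snoc sum_distrib_left)
    also have "\<dots> \<le> (\<Sum>v\<in>wordsn n. (\<Prod>j<n - k. q (take (Suc k) (drop j v))) * 1)"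
      using False by (intro sum_mono mult_left_mono sum prod_nonneg) (auto simp: q)
    finally show ?thesis using Suc by simp
  qed
qed simp

section \<open>Shift-invariant measures and their words\<close>

lemma space_Omega [simp]: "space Omega = UNIV"
  by (simp add: Omega_def space_PiM PiE_def)

lemma measurable_coord [measurable]: "(\<lambda>x. x i) \<in> measurable Omega (count_space UNIV)"
  unfolding Omega_def by (rule measurable_component_singleton) simp

lemma measurable_into_Omega:
  assumes "\<And>i. (\<lambda>z. f z i) \<in> measurable N (count_space UNIV)"
  shows "f \<in> measurable N Omega"
  unfolding Omega_def by (rule measurable_PiM_single') (use assms in \<open>auto simp: PiE_def\<close>)

lemma measurable_shift [measurable]: "shift \<in> measurable Omega Omega"
  by (rule measurable_into_Omega) (simp add: shift_def)

lemma measurable_Mult [measurable]: "Mult \<in> measurable (Omega \<Otimes>\<^sub>M Omega) Omega"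
  by (rule measurable_into_Omega) (simp add: Mult_def)

lemma measurable_shift_prod [measurable]:
  "map_prod shift shift \<in> measurable (Omega \<Otimes>\<^sub>M Omega) (Omega \<Otimes>\<^sub>M Omega)"
  unfolding map_prod_def by measurable

lemma cyl_sets [measurable]: "cyl w \<in> sets Omega"
proof -
  have "{x \<in> space Omega. \<forall>i\<in>{..<length w}. x (int i) = w ! i} \<in> sets Omega"
    by measurable
  then show ?thesis by (simp add: cyl_def Ball_def lessThan_def)
qed

lemma shift_funpow: "(shift ^^ n) x = (\<lambda>i. x (i + int n))"
  by (induction n arbitrary: x) (auto simp: shift_def funpow_Suc_right add_ac simp del: funpow.simps)

text \<open>Stated for an arbitrary map \<open>T\<close>, because it is applied both to the shift
  with the letter \<open>x 0\<close> and to the double shift with a pair of letters.\<close>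

definition process :: "'z measure \<Rightarrow> ('z \<Rightarrow> 'z) \<Rightarrow> ('z \<Rightarrow> 'a) \<Rightarrow> 'a list \<Rightarrow> real" where
  "process N T f v = measure N {z \<in> space N. \<forall>i<length v. f ((T ^^ i) z) = v ! i}"

locale factor_map = prob_space N
  for N :: "'z measure" and T :: "'z \<Rightarrow> 'z" and f :: "'z \<Rightarrow> 'a::finite" +
  assumes T [measurable]: "T \<in> measurable N N" and inv: "distr N N T = N"
    and f [measurable]: "f \<in> measurable N (count_space UNIV)"
begin

lemma T_funpow [measurable]: "T ^^ n \<in> measurable N N"
  by (rule measurable_compose_n[OF T])

lemma word_sets: "{z \<in> space N. \<forall>i<length v. f ((T ^^ i) z) = v ! i} \<in> sets N"
proof -
  have "{z \<in> space N. \<forall>i\<in>{..<length v}. f ((T ^^ i) z) = v ! i} \<in> sets N"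
    by measurable
  then show ?thesis by (simp add: Ball_def lessThan_def)
qed

lemma sum_measure_letters:
  assumes "A \<in> sets N" and [measurable]: "g \<in> measurable N (count_space UNIV)"
  shows "(\<Sum>a\<in>UNIV. measure N {z \<in> A. g z = (a::'a)}) = measure N A"
proof -
  have "{z \<in> A. g z = a} = A \<inter> {z \<in> space N. g z = a}" for a
    using sets.sets_into_space[OF assms(1)] by auto
  then have "{z \<in> A. g z = a} \<in> sets N" for a
    using assms(1) by simp
  then have "measure N (\<Union>a\<in>UNIV. {z \<in> A. g z = a}) = (\<Sum>a\<in>UNIV. measure N {z \<in> A. g z = a})"
    by (intro finite_measure_finite_Union) (auto simp: disjoint_family_on_def)
  moreover have "(\<Union>a\<in>UNIV. {z \<in> A. g z = a}) = A" by auto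
  ultimately show ?thesis by simp
qed

text \<open>\<open>snoc\<close> is additivity over the letter read at the next time. For
  \<open>cons\<close>, prepending a letter pulls the cylinder back under \<open>T\<close>, and
  invariance of \<open>N\<close> restores its measure.\<close>

lemma stationary_process: "stationary (process N T f)"
proof
  fix v :: "'a list"
  let ?C = "{z \<in> space N. \<forall>i<length v. f ((T ^^ i) z) = v ! i}"
  show "0 \<le> process N T f v" by (simp add: process_def)
  show "process N T f [] = 1" by (simp add: process_def prob_space)
  have "process N T f (v @ [a]) = measure N {z \<in> ?C. f ((T ^^ length v) z) = a}" for a
    unfolding process_def
    by (intro arg_cong[where f = "measure N"]) (auto simp: nth_append less_Suc_eq)
  then show "(\<Sum>a\<in>UNIV. process N T f (v @ [a])) = process N T f v"
    using sum_measure_letters[OF word_sets[of v], of "\<lambda>z. f ((T ^^ length v) z)"]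
    by (simp add: process_def)
  have "process N T f (a # v) = measure N {z \<in> T -` ?C \<inter> space N. f z = a}" for a
    unfolding process_def using measurable_space[OF T]
    by (intro arg_cong[where f = "measure N"])
       (auto simp: nth_Cons less_Suc_eq_0_disj funpow_Suc_right simp del: funpow.simps split: nat.splits)
  then have "(\<Sum>a\<in>UNIV. process N T f (a # v)) = measure N (T -` ?C \<inter> space N)"
    using sum_measure_letters[OF measurable_sets[OF T word_sets[of v]] f] by simp
  also have "\<dots> = measure (distr N N T) ?C"
    by (rule measure_distr[symmetric, OF T word_sets])
  finally show "(\<Sum>a\<in>UNIV. process N T f (a # v)) = process N T f v"
    by (simp add: inv process_def)
qed

lemma factor_process:
  fixes g :: "'a \<Rightarrow> 'b::finite"
  shows "factor g (process N T f) = process N T (\<lambda>z. g (f z))"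
proof
  fix u :: "'b list"
  let ?C = "\<lambda>v. {z \<in> space N. \<forall>i<length v. f ((T ^^ i) z) = v ! i}"
  let ?V = "{v \<in> wordsn (length u). map g v = u}"
  have fin: "finite ?V" by (rule finite_subset[OF _ finite_wordsn[of "length u"]]) auto
  have disj: "disjoint_family_on ?C ?V"
    unfolding disjoint_family_on_def
  proof (intro ballI impI)
    fix v w assume "v \<in> ?V" "w \<in> ?V" "v \<noteq> w"
    then obtain i where "i < length v" "v ! i \<noteq> w ! i" "length w = length v"
      by (auto simp: list_eq_iff_nth_eq)
    then show "?C v \<inter> ?C w = {}" by auto
  qed
  have "{z \<in> space N. \<forall>i<length u. g (f ((T ^^ i) z)) = u ! i} = (\<Union>v\<in>?V. ?C v)"
  proof (intro equalityI subsetI)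
    fix z assume z: "z \<in> {z \<in> space N. \<forall>i<length u. g (f ((T ^^ i) z)) = u ! i}"
    then show "z \<in> (\<Union>v\<in>?V. ?C v)"
      by (intro UN_I[of "map (\<lambda>i. f ((T ^^ i) z)) [0..<length u]"]) (auto intro!: nth_equalityI)
  qed (auto simp: list_eq_iff_nth_eq)
  then have "process N T (\<lambda>z. g (f z)) u = measure N (\<Union>v\<in>?V. ?C v)"
    by (simp add: process_def)
  also have "\<dots> = (\<Sum>v\<in>?V. process N T f v)"
    unfolding process_def
    by (rule finite_measure_finite_Union[OF fin _ disj]) (use word_sets in blast)
  also have "\<dots> = factor g (process N T f) u"
    unfolding factor_def by (intro sum.mono_neutral_cong_left) auto
  finally show "factor g (process N T f) u = process N T (\<lambda>z. g (f z)) u" by simp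
qed

end

section \<open>Word laws of invariant measures\<close>

lemma inv_measD:
  assumes "\<mu> \<in> inv_meas Y"
  shows "sets \<mu> = sets Omega" "space \<mu> = UNIV" "prob_space \<mu>" "distr \<mu> Omega shift = \<mu>"
    "emeasure \<mu> Y = 1"
  using assms sets_eq_imp_space_eq[of \<mu> Omega] by (auto simp: inv_meas_def)

lemma inv_meas2D:
  assumes "L \<in> inv_meas2"
  shows "sets L = sets (Omega \<Otimes>\<^sub>M Omega)" "space L = UNIV" "prob_space L"
    "distr L (Omega \<Otimes>\<^sub>M Omega) (map_prod shift shift) = L"
  using assms sets_eq_imp_space_eq[of L "Omega \<Otimes>\<^sub>M Omega"]
  by (auto simp: inv_meas2_def space_pair_measure)

definition word_prob :: "config measure \<Rightarrow> bool list \<Rightarrow> real" where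
  "word_prob \<mu> w = measure \<mu> (cyl w)"

lemma block_entropy_eq: "block_entropy \<mu> n = word_entropy (word_prob \<mu>) n"
  by (simp add: block_entropy_def word_entropy_def word_prob_def wordsn_def)

lemma ent_eq: "ent \<mu> = lim (\<lambda>n. word_entropy (word_prob \<mu>) n / real n)"
  by (simp add: ent_def block_entropy_eq)

lemma factor_map_shift:
  assumes "\<mu> \<in> inv_meas Y"
  shows "factor_map \<mu> shift (\<lambda>x. x 0)"
proof -
  note i = inv_measD[OF assms]
  interpret prob_space \<mu> by (rule i)
  show ?thesis
  proof
    show "shift \<in> measurable \<mu> \<mu>"
      using measurable_shift by (simp only: measurable_cong_sets[OF i(1) i(1)])
    show "distr \<mu> \<mu> shift = \<mu>"
      using i(4) distr_cong[OF refl i(1), of \<mu> shift shift] by simp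
    show "(\<lambda>x. x 0) \<in> measurable \<mu> (count_space UNIV)"
      using measurable_coord[of 0] by (simp only: measurable_cong_sets[OF i(1) refl])
  qed
qed

lemma word_prob_process: "\<mu> \<in> inv_meas Y \<Longrightarrow> word_prob \<mu> = process \<mu> shift (\<lambda>x. x 0)"
  by (intro ext) (simp add: word_prob_def process_def shift_funpow cyl_def inv_measD(2))

lemma stationary_word_prob: "\<mu> \<in> inv_meas Y \<Longrightarrow> stationary (word_prob \<mu>)"
  using factor_map.stationary_process[OF factor_map_shift] word_prob_process by metis

text \<open>\<open>ent\<close> is written with \<open>lim\<close>, which is informative only when
  the sequence converges; this is supplied here, together with the fact that the rate bounds the
  entropy of each length from below.\<close>

lemma ent_limit:
  assumes "\<mu> \<in> inv_meas Y"
  shows "(\<lambda>n. word_entropy (word_prob \<mu>) n / real n) \<longlonglongrightarrow> ent \<mu>"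
    and "real n * ent \<mu> \<le> word_entropy (word_prob \<mu>) n"
proof -
  obtain h where h: "(\<lambda>n. word_entropy (word_prob \<mu>) n / real n) \<longlonglongrightarrow> h"
    "\<And>n. real n * h \<le> word_entropy (word_prob \<mu>) n"
    using stationary.entropy_rate[OF stationary_word_prob[OF assms]] by blast
  then have "ent \<mu> = h" unfolding ent_eq by (intro limI)
  with h show "(\<lambda>n. word_entropy (word_prob \<mu>) n / real n) \<longlonglongrightarrow> ent \<mu>"
    "real n * ent \<mu> \<le> word_entropy (word_prob \<mu>) n" by auto
qed

lemma shift_invariant_measure:
  assumes "\<mu> \<in> inv_meas Y" and P: "{x. P x} \<in> sets Omega"
  shows "measure \<mu> {x. P (\<lambda>i. x (i + int n))} = measure \<mu> {x. P x}"
proof (induction n)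
  case (Suc n)
  note i = inv_measD[OF assms(1)]
  have meas: "{x. P (\<lambda>i. x (i + int n))} \<in> sets Omega"
    using measurable_sets[OF measurable_compose_n[OF measurable_shift] P, of n]
    by (simp add: vimage_def shift_funpow)
  have "measure \<mu> {x. P (\<lambda>i. x (i + int n))}
      = measure (distr \<mu> Omega shift) {x. P (\<lambda>i. x (i + int n))}" by (simp add: i)
  also have "\<dots> = measure \<mu> {x. P (\<lambda>i. x (i + int (Suc n)))}"
    using measurable_shift
    by (subst measure_distr[OF _ meas])
       (simp_all only: measurable_cong_sets[OF i(1) refl], simp add: i vimage_def shift_def add_ac)
  finally show ?case using Suc by simp
qed simp

text \<open>A box over any finite set of coordinates is a finite disjoint union of boxes over a
  symmetric window.\<close>

lemma Omega_eqI:
  assumes sets: "sets M = sets Omega" "sets N = sets Omega" and "prob_space M"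
    and eq: "\<And>n v. measure M {x. \<forall>i\<in>{- int n..<int n}. x i = v i}
                   = measure N {x. \<forall>i\<in>{- int n..<int n}. x i = v i}"
    and "prob_space N"
  shows "M = N"
proof -
  interpret M: prob_space M by fact
  interpret N: prob_space N by fact
  show ?thesis
  proof (rule measure_eqI_PiM_infinite[where I = UNIV and M = "\<lambda>_. count_space UNIV"])
    show "sets M = sets (Pi\<^sub>M UNIV (\<lambda>_. count_space UNIV))"
      "sets N = sets (Pi\<^sub>M UNIV (\<lambda>_. count_space UNIV))"
      using sets by (simp_all add: Omega_def)
    show "finite_measure M" by unfold_locales
    fix A :: "int \<Rightarrow> bool set" and J :: "int set" assume J: "finite J"
    obtain n :: nat where n: "\<And>i. i \<in> J \<Longrightarrow> nat \<bar>i\<bar> < n"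
      using J finite_nat_set_iff_bounded[of "(\<lambda>i. nat \<bar>i\<bar>) ` J"] by auto
    let ?I = "{- int n..<int n}"
    have JI: "J \<subseteq> ?I"
    proof
      fix i assume "i \<in> J"
      with n[of i] show "i \<in> ?I" by (simp; linarith)
    qed
    let ?S = "{x. \<forall>i\<in>J. x i \<in> A i}"
    let ?B = "\<lambda>v. {x :: config. \<forall>i\<in>?I. x i = v i}"
    \<comment> \<open>One representative for each pattern on the window, normalised to be False
      outside; this makes the index set finite.\<close>
    let ?V = "{v \<in> ?S. \<forall>i. i \<notin> ?I \<longrightarrow> \<not> v i}"
    have "?V \<subseteq> (\<lambda>F i. i \<in> F) ` Pow ?I"
    proof
      fix v assume "v \<in> ?V"
      then show "v \<in> (\<lambda>F i. i \<in> F) ` Pow ?I" by (intro image_eqI[of _ _ "{i. v i}"]) auto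
    qed
    then have fin: "finite ?V" by (rule finite_subset) auto
    have B: "?B v \<in> sets Omega" for v
    proof -
      have "{x \<in> space Omega. \<forall>i\<in>?I. x i = v i} \<in> sets Omega" by measurable
      then show ?thesis by simp
    qed
    have S: "?S = (\<Union>v\<in>?V. ?B v)"
    proof (intro equalityI subsetI)
      fix x assume "x \<in> ?S"
      then show "x \<in> (\<Union>v\<in>?V. ?B v)"
        using JI by (intro UN_I[of "\<lambda>i. i \<in> ?I \<and> x i"]) auto
    next
      fix x assume "x \<in> (\<Union>v\<in>?V. ?B v)"
      then show "x \<in> ?S" using JI by fastforce
    qed
    have disj: "disjoint_family_on ?B ?V"
      unfolding disjoint_family_on_def
    proof (intro ballI impI)
      fix v w assume vw: "v \<in> ?V" "w \<in> ?V" "v \<noteq> w"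
      then obtain i where i: "v i \<noteq> w i" by blast
      with vw have "i \<in> ?I" by blast
      with i show "?B v \<inter> ?B w = {}" by blast
    qed
    have "measure M ?S = measure M (\<Union>v\<in>?V. ?B v)"
      using S by (rule arg_cong)
    also have "\<dots> = (\<Sum>v\<in>?V. measure M (?B v))"
      by (rule M.finite_measure_finite_Union[OF fin _ disj]) (use B sets in auto)
    also have "\<dots> = (\<Sum>v\<in>?V. measure N (?B v))" by (simp add: eq)
    also have "\<dots> = measure N (\<Union>v\<in>?V. ?B v)"
      by (rule N.finite_measure_finite_Union[symmetric, OF fin _ disj]) (use B sets in auto)
    also have "\<dots> = measure N ?S"
      using S[symmetric] by (rule arg_cong)
    finally have "emeasure M ?S = emeasure N ?S"
      by (simp add: M.emeasure_eq_measure N.emeasure_eq_measure)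
    moreover have "prod_emb UNIV (\<lambda>_. count_space UNIV) J (Pi\<^sub>E J A) = ?S"
      by (auto simp: prod_emb_def space_PiM PiE_def Pi_def restrict_def extensional_def)
    ultimately show "emeasure M (prod_emb UNIV (\<lambda>_. count_space UNIV) J (Pi\<^sub>E J A))
      = emeasure N (prod_emb UNIV (\<lambda>_. count_space UNIV) J (Pi\<^sub>E J A))" by simp
  qed
qed

text \<open>Invariance moves the window [-n, n) to [0, 2n), where it is the cylinder of a
  word.\<close>

lemma inv_meas_eqI:
  assumes M: "M \<in> inv_meas Y" and N: "N \<in> inv_meas Z" and eq: "word_prob M = word_prob N"
  shows "M = N"
proof (rule Omega_eqI)
  fix n v
  let ?P = "\<lambda>x :: config. \<forall>i\<in>{- int n..<int n}. x i = v i"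
  have "{x \<in> space Omega. ?P x} \<in> sets Omega" by measurable
  then have P: "{x. ?P x} \<in> sets Omega" by simp
  have cyl: "{x. ?P (\<lambda>i. x (i + int n))} = cyl (map (\<lambda>j. v (int j - int n)) [0..<2 * n])"
  proof (intro equalityI subsetI)
    fix x assume "x \<in> {x. ?P (\<lambda>i. x (i + int n))}"
    then have "x (int j) = v (int j - int n)" if "j < 2 * n" for j
      using that by (auto dest: bspec[of _ _ "int j - int n"])
    then show "x \<in> cyl (map (\<lambda>j. v (int j - int n)) [0..<2 * n])" by (simp add: cyl_def)
  next
    fix x assume "x \<in> cyl (map (\<lambda>j. v (int j - int n)) [0..<2 * n])"
    then have x: "x (int j) = v (int j - int n)" if "j < 2 * n" for j
      using that by (auto simp: cyl_def)
    have "x (i + int n) = v i" if "i \<in> {- int n..<int n}" for i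
      using x[of "nat (i + int n)"] that by auto
    then show "x \<in> {x. ?P (\<lambda>i. x (i + int n))}" by simp
  qed
  show "measure M {x. ?P x} = measure N {x. ?P x}"
    using shift_invariant_measure[OF M P, of n] shift_invariant_measure[OF N P, of n]
      fun_cong[OF eq, of "map (\<lambda>j. v (int j - int n)) [0..<2 * n]"]
    unfolding cyl word_prob_def by simp
qed (use inv_measD[OF M] inv_measD[OF N] in auto)

text \<open>The second letter is z = x y and not y: the values of y where x is 0 are lost under
  \<open>Mult\<close> and would add entropy that z does not have.\<close>

definition pair_prob :: "(config \<times> config) measure \<Rightarrow> (bool \<times> bool) list \<Rightarrow> real" where
  "pair_prob L = process L (map_prod shift shift) (\<lambda>z. (fst z 0, Mult z 0))"

lemma map_prod_funpow:
  fixes f :: "'a \<Rightarrow> 'a" and g :: "'b \<Rightarrow> 'b"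
  shows "(map_prod f g ^^ n) z = ((f ^^ n) (fst z), (g ^^ n) (snd z))"
  by (cases z, induction n) auto

lemma Mult_shift: "Mult ((map_prod shift shift ^^ n) z) 0 = Mult z (int n)"
  by (simp add: map_prod_funpow Mult_def shift_funpow)

lemma pair_prob_eq:
  "L \<in> inv_meas2 \<Longrightarrow>
   pair_prob L v = measure L {z. \<forall>i<length v. (fst z (int i), Mult z (int i)) = v ! i}"
  by (simp add: pair_prob_def process_def Mult_shift inv_meas2D) (simp add: map_prod_funpow shift_funpow)

lemma factor_map_pair:
  assumes "L \<in> inv_meas2"
  shows "factor_map L (map_prod shift shift) (\<lambda>z. (fst z 0, Mult z 0))"
proof -
  note i = inv_meas2D[OF assms]
  interpret prob_space L by (rule i)
  show ?thesis
  proof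
    show "map_prod shift shift \<in> measurable L L"
      using measurable_shift_prod by (simp only: measurable_cong_sets[OF i(1) i(1)])
    show "distr L L (map_prod shift shift) = L"
      using i(4) distr_cong[OF refl i(1), of L "map_prod shift shift" "map_prod shift shift"] by simp
    have "(\<lambda>z. (fst z 0, Mult z 0)) \<in> measurable (Omega \<Otimes>\<^sub>M Omega) (count_space UNIV \<Otimes>\<^sub>M count_space UNIV)"
      by measurable
    then show "(\<lambda>z. (fst z 0, Mult z 0)) \<in> measurable L (count_space UNIV)"
      by (simp only: measurable_cong_sets[OF i(1) refl]) (simp add: pair_measure_countable)
  qed
qed

lemma stationary_pair_prob: "L \<in> inv_meas2 \<Longrightarrow> stationary (pair_prob L)"
  unfolding pair_prob_def by (rule factor_map.stationary_process[OF factor_map_pair])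

lemma factor_pair_prob:
  assumes "L \<in> inv_meas2"
  shows "factor fst (pair_prob L) = word_prob (distr L Omega fst)"
    and "factor snd (pair_prob L) = word_prob (distr L Omega Mult)"
proof -
  note i = inv_meas2D[OF assms]
  have [measurable]: "fst \<in> measurable L Omega" "Mult \<in> measurable L Omega"
    using measurable_fst[of Omega Omega] measurable_Mult
    by (simp_all only: measurable_cong_sets[OF i(1) refl])
  show "factor fst (pair_prob L) = word_prob (distr L Omega fst)"
    unfolding pair_prob_def factor_map.factor_process[OF factor_map_pair[OF assms]]
    by (intro ext) (simp add: process_def word_prob_def measure_distr i cyl_def vimage_def
        map_prod_funpow shift_funpow measure_distr[OF _ cyl_sets, unfolded cyl_def])
  show "factor snd (pair_prob L) = word_prob (distr L Omega Mult)"
    unfolding pair_prob_def factor_map.factor_process[OF factor_map_pair[OF assms]]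
    by (intro ext) (simp add: process_def word_prob_def i cyl_def vimage_def Mult_shift
        measure_distr[OF _ cyl_sets, unfolded cyl_def])
qed

section \<open>Subordinate measures over a zero-entropy base\<close>

lemma sum_UNIV_bool_pair:
  "(\<Sum>a\<in>UNIV. h a) = h (True, True) + h (True, False) + h (False, True) + h (False, False)"
  for h :: "bool \<times> bool \<Rightarrow> real"
  by (simp add: UNIV_bool UNIV_Times_UNIV[symmetric] del: UNIV_Times_UNIV)

lemma word_prob_True: "word_prob \<nu> [True] = measure \<nu> {x. x 0}"
  by (simp add: word_prob_def cyl_def)

text \<open>The conditional law of z given x when y is a fair coin: uniform where x is 1, forced to
  be 0 where x is 0.\<close>

definition kernel :: "bool \<times> bool \<Rightarrow> real" where
  "kernel a = (if fst a then 1/2 else if snd a then 0 else 1)"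

lemma kernel_nonneg: "0 \<le> kernel a"
  by (simp add: kernel_def)

lemma sum_kernel: "(\<Sum>a\<in>UNIV. kernel a * of_bool (fst a = b)) \<le> 1"
  by (cases b) (simp_all add: sum_UNIV_bool_pair kernel_def)

context
  fixes L \<nu> assumes L: "L \<in> inv_meas2" and \<nu>: "distr L Omega fst = \<nu>"
begin

interpretation stationary "pair_prob L"
  by (rule stationary_pair_prob[OF L])

lemma pair_prob_False_True: "pair_prob L [(False, True)] = 0"
proof -
  have "{z. \<forall>i<length [(False, True)]. (fst z (int i), Mult z (int i)) = [(False, True)] ! i} = {}"
    by (auto simp: Mult_def)
  then show ?thesis by (simp only: pair_prob_eq[OF L] measure_empty)
qed

lemma pair_kernel_pos: "pair_prob L [a] > 0 \<Longrightarrow> kernel a > 0"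
proof (cases "a = (False, True)")
  case False
  then show "kernel a > 0" by (cases a) (auto simp: kernel_def)
qed (simp add: pair_prob_False_True)

lemma factor_fst: "factor fst (pair_prob L) = word_prob \<nu>"
  using factor_pair_prob(1)[OF L] \<nu> by simp

text \<open>A letter with x = 1 costs log 2 (1/2) = -1, the letter (0, 0) costs 0, and (0, 1) has
  probability 0. This is where \<nu>(1) enters.\<close>

lemma kernel_mean: "(\<Sum>a\<in>UNIV. pair_prob L [a] * log 2 (kernel a)) = - measure \<nu> {x. x 0}"
proof -
  have "measure \<nu> {x. x 0} = factor fst (pair_prob L) [True]"
    by (simp add: factor_fst word_prob_True)
  also have "\<dots> = pair_prob L [(True, True)] + pair_prob L [(True, False)]"
    by (simp add: factor_def sum_wordsn_1 sum_UNIV_bool_pair)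
  finally show ?thesis
    by (simp add: sum_UNIV_bool_pair kernel_def pair_prob_False_True log_divide)
qed

lemma pair_entropy:
  shows pair_entropy_le: "word_entropy (pair_prob L) n
      \<le> word_entropy (word_prob \<nu>) n + real n * measure \<nu> {x. x 0}"
    and pair_entropy_max: "word_entropy (word_prob \<nu>) n + real n * measure \<nu> {x. x 0}
      \<le> word_entropy (pair_prob L) n \<Longrightarrow> length v = n \<Longrightarrow>
      pair_prob L v = word_prob \<nu> (map fst v) * prod_list (map kernel v)"
    and pair_entropy_kernel: "(\<And>v. pair_prob L v = word_prob \<nu> (map fst v) * prod_list (map kernel v)) \<Longrightarrow>
      word_entropy (pair_prob L) n = word_entropy (word_prob \<nu>) n + real n * measure \<nu> {x. x 0}"
proof -
  note e = entropy_le_kernel[where f = fst and \<kappa> = kernel, OF kernel_nonneg sum_kernel pair_kernel_pos,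
      unfolded factor_fst kernel_mean]
  show "word_entropy (pair_prob L) n \<le> word_entropy (word_prob \<nu>) n + real n * measure \<nu> {x. x 0}"
    using e(1)[of n] by simp
  show "pair_prob L v = word_prob \<nu> (map fst v) * prod_list (map kernel v)"
    if "word_entropy (word_prob \<nu>) n + real n * measure \<nu> {x. x 0} \<le> word_entropy (pair_prob L) n"
      "length v = n"
    by (rule e(2)[of n]) (use that in simp_all)
  show "word_entropy (pair_prob L) n = word_entropy (word_prob \<nu>) n + real n * measure \<nu> {x. x 0}"
    if "\<And>v. pair_prob L v = word_prob \<nu> (map fst v) * prod_list (map kernel v)"
  proof -
    have "word_entropy (pair_prob L) n = word_entropy (word_prob \<nu>) n - real n * - measure \<nu> {x. x 0}"
      by (rule e(3)) (assumption | rule that)+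
    then show ?thesis by simp
  qed
qed

lemma word_entropy_Mult_le: "word_entropy (word_prob (distr L Omega Mult)) n \<le> word_entropy (pair_prob L) n"
  using entropy_factor_le[where f = snd and n = n] factor_pair_prob(2)[OF L] by simp

lemma inv_meas_Mult: "distr L Omega Mult \<in> inv_meas UNIV"
proof -
  note i = inv_meas2D[OF L]
  interpret L: prob_space L by (rule i)
  have [measurable]: "Mult \<in> measurable L Omega"
    using measurable_Mult by (simp only: measurable_cong_sets[OF i(1) refl])
  have p: "prob_space (distr L Omega Mult)" by (rule L.prob_space_distr) measurable
  have "distr (distr L Omega Mult) Omega shift = distr L Omega (shift \<circ> Mult)"
    by (intro distr_distr) measurable
  also have "shift \<circ> Mult = Mult \<circ> map_prod shift shift"
    by (auto simp: Mult_def shift_def fun_eq_iff)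
  also have "distr L Omega (Mult \<circ> map_prod shift shift)
      = distr (distr L (Omega \<Otimes>\<^sub>M Omega) (map_prod shift shift)) Omega Mult"
    using measurable_shift_prod
    by (intro distr_distr[symmetric] measurable_Mult) (simp only: measurable_cong_sets[OF i(1) refl])
  finally show ?thesis
    using prob_space.emeasure_space_1[OF p] p i by (simp add: inv_meas_def)
qed

lemma inv_meas_fst: "\<nu> \<in> inv_meas UNIV"
proof -
  note i = inv_meas2D[OF L]
  interpret L: prob_space L by (rule i)
  have [measurable]: "fst \<in> measurable L Omega"
    using measurable_fst by (simp only: measurable_cong_sets[OF i(1) refl])
  have p: "prob_space (distr L Omega fst)" by (rule L.prob_space_distr) measurable
  have "distr (distr L Omega fst) Omega shift = distr L Omega (shift \<circ> fst)"
    by (intro distr_distr) measurable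
  also have "shift \<circ> fst = fst \<circ> map_prod shift shift"
    by (auto simp: fun_eq_iff)
  also have "distr L Omega (fst \<circ> map_prod shift shift)
      = distr (distr L (Omega \<Otimes>\<^sub>M Omega) (map_prod shift shift)) Omega fst"
    using measurable_shift_prod
    by (intro distr_distr[symmetric] measurable_fst) (simp only: measurable_cong_sets[OF i(1) refl])
  finally show ?thesis
    using prob_space.emeasure_space_1[OF p] p i \<nu> by (auto simp: inv_meas_def)
qed

context
  assumes zero: "ent \<nu> = 0"
begin

lemma ent_Mult_le: "ent (distr L Omega Mult) \<le> measure \<nu> {x. x 0}"
proof -
  have "(\<lambda>n. word_entropy (word_prob \<nu>) n / real n + measure \<nu> {x. x 0}) \<longlonglongrightarrow> 0 + measure \<nu> {x. x 0}"
    using ent_limit(1)[OF inv_meas_fst] unfolding zero by (intro tendsto_add tendsto_const)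
  then have lim: "(\<lambda>n. word_entropy (word_prob \<nu>) n / real n + measure \<nu> {x. x 0}) \<longlonglongrightarrow> measure \<nu> {x. x 0}"
    by simp
  show ?thesis
  proof (rule LIMSEQ_le_const[OF lim], intro exI[of _ 1] allI impI)
    fix n :: nat assume n: "1 \<le> n"
    have "real n * ent (distr L Omega Mult) \<le> word_entropy (word_prob \<nu>) n + real n * measure \<nu> {x. x 0}"
      using ent_limit(2)[OF inv_meas_Mult, of n] word_entropy_Mult_le[of n] pair_entropy_le[of n] by linarith
    then show "ent (distr L Omega Mult) \<le> word_entropy (word_prob \<nu>) n / real n + measure \<nu> {x. x 0}"
      using n by (simp add: field_simps)
  qed
qed

text \<open>The deviation of the relative entropy of \<open>k\<close>-words from its maximum is bounded, after
  subdividing words of length \<open>m * k\<close>, by the entropy of \<open>\<nu>\<close> per \<open>k\<close> letters.\<close>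
lemma maximal_pair_prob:
  assumes max: "measure \<nu> {x. x 0} \<le> ent (distr L Omega Mult)"
  shows "pair_prob L v = word_prob \<nu> (map fst v) * prod_list (map kernel v)"
\<comment> \<open>The empty word is treated apart, since the multiples \<open>m * k\<close> below
  must tend to infinity.\<close>
proof (cases "v = []")
  case True
  then show ?thesis
    using nil stationary.nil[OF stationary_word_prob[OF inv_meas_fst]] by simp
next
  case False
  define k where "k = length v"
  have k: "k > 0" using False by (simp add: k_def)
  let ?h = "\<lambda>n. word_entropy (word_prob \<nu>) n" and ?c = "measure \<nu> {x. x 0}"
  \<comment> \<open>Maximal entropy bounds the relative entropy of \<open>m * k\<close>-words from
    below, and subadditivity bounds it from above by \<open>m\<close> times that of
    \<open>k\<close>-words; the bound follows after division by \<open>m\<close>.\<close>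
  have bound: "real k * ?c - real k * (?h (m * k) / real (m * k)) \<le> word_entropy (pair_prob L) k - ?h k"
    if m: "m \<ge> 1" for m
  proof -
    have "real (m * k) * ?c \<le> real (m * k) * ent (distr L Omega Mult)"
      using max by (intro mult_left_mono) auto
    also have "\<dots> \<le> word_entropy (pair_prob L) (m * k)"
      using ent_limit(2)[OF inv_meas_Mult, of "m * k"] word_entropy_Mult_le[of "m * k"] by linarith
    finally have "real (m * k) * ?c - ?h (m * k) \<le> real m * (word_entropy (pair_prob L) k - ?h k)"
      using cond_entropy_mult[where f = fst and n = m and k = k] by (simp add: factor_fst)
    then have "(real (m * k) * ?c - ?h (m * k)) / real m \<le> word_entropy (pair_prob L) k - ?h k"
      using m by (simp add: field_simps)
    moreover have "(real (m * k) * ?c - ?h (m * k)) / real m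
        = real k * ?c - real k * (?h (m * k) / real (m * k))"
      using m k by (simp add: field_simps)
    ultimately show ?thesis by simp
  qed
  have "strict_mono (\<lambda>m. m * k)" using k by (auto simp: strict_mono_def)
  then have "(\<lambda>m. ?h (m * k) / real (m * k)) \<longlonglongrightarrow> 0"
    using LIMSEQ_subseq_LIMSEQ[OF ent_limit(1)[OF inv_meas_fst, unfolded zero]] by (simp only: comp_def)
  then have "(\<lambda>m. real k * ?c - real k * (?h (m * k) / real (m * k))) \<longlonglongrightarrow> real k * ?c - real k * 0"
    by (intro tendsto_diff tendsto_mult tendsto_const)
  then have "real k * ?c - real k * 0 \<le> word_entropy (pair_prob L) k - ?h k"
    by (rule LIMSEQ_le_const2) (intro exI[of _ 1] allI impI bound)
  then show ?thesis
    by (intro pair_entropy_max[of k]) (auto simp: k_def)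
qed

end

end

section \<open>The product of the base with the fair coin measure\<close>

interpretation coin: product_prob_space "\<lambda>_::int. measure_pmf (bernoulli_pmf (1/2))" UNIV
  by unfold_locales

lemma sets_Bernoulli_half: "sets Bernoulli_half = sets Omega"
  unfolding Bernoulli_half_def Omega_def by (rule sets_PiM_cong) auto

lemma prob_space_Bernoulli_half: "prob_space Bernoulli_half"
  unfolding Bernoulli_half_def by (rule coin.prob_space_axioms)

lemma Bernoulli_half_box:
  assumes "finite J"
  shows "measure Bernoulli_half {y. \<forall>i\<in>J. y i = v i} = (1/2) ^ card J"
proof -
  have "{y. \<forall>i\<in>J. y i = v i}
      = prod_emb UNIV (\<lambda>_. measure_pmf (bernoulli_pmf (1/2))) J (Pi\<^sub>E J (\<lambda>i. {v i}))"
    by (auto simp: prod_emb_def PiE_def Pi_def restrict_def extensional_def)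
  then have "measure Bernoulli_half {y. \<forall>i\<in>J. y i = v i}
      = (\<Prod>i\<in>J. measure (measure_pmf (bernoulli_pmf (1/2))) {v i})"
    unfolding Bernoulli_half_def using assms by (simp add: coin.measure_PiM_emb)
  also have "\<dots> = (\<Prod>i\<in>J. 1/2)"
    by (intro prod.cong refl) (simp add: measure_pmf_single pmf_bernoulli_half)
  finally show ?thesis by simp
qed

text \<open>The measure of a box depends only on the number of its coordinates, which translation
  preserves.\<close>

lemma shift_Bernoulli_half: "distr Bernoulli_half Omega shift = Bernoulli_half"
proof (rule Omega_eqI)
  interpret prob_space Bernoulli_half by (rule prob_space_Bernoulli_half)
  have m: "shift \<in> measurable Bernoulli_half Omega"
    using measurable_shift by (simp only: measurable_cong_sets[OF sets_Bernoulli_half refl])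
  then show "prob_space (distr Bernoulli_half Omega shift)" by (rule prob_space_distr)
  fix n :: nat and v :: config
  let ?I = "{- int n..<int n}"
  have "{x \<in> space Omega. \<forall>i\<in>?I. x i = v i} \<in> sets Omega" by measurable
  then have "measure (distr Bernoulli_half Omega shift) {x. \<forall>i\<in>?I. x i = v i}
      = measure Bernoulli_half (shift -` {x. \<forall>i\<in>?I. x i = v i} \<inter> space Bernoulli_half)"
    using m by (intro measure_distr) auto
  also have "shift -` {x. \<forall>i\<in>?I. x i = v i} \<inter> space Bernoulli_half
      = {x. \<forall>i\<in>(\<lambda>i. i + 1) ` ?I. x i = v (i - 1)}"
    using sets_eq_imp_space_eq[OF sets_Bernoulli_half]
    by (simp only: space_Omega Int_UNIV_right vimage_def shift_def mem_Collect_eq ball_simps Ball_image_comp comp_def add_diff_cancel_right')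
  also have "measure Bernoulli_half \<dots> = (1/2) ^ card ((\<lambda>i. i + 1) ` ?I)"
    by (rule Bernoulli_half_box) simp
  also have "card ((\<lambda>i. i + 1) ` ?I) = card ?I"
    by (rule card_image) (auto intro: inj_onI)
  also have "(1/2) ^ card ?I = measure Bernoulli_half {x. \<forall>i\<in>?I. x i = v i}"
    by (rule Bernoulli_half_box[symmetric]) simp
  finally show "measure (distr Bernoulli_half Omega shift) {x. \<forall>i\<in>?I. x i = v i}
      = measure Bernoulli_half {x. \<forall>i\<in>?I. x i = v i}" .
qed (simp_all add: sets_Bernoulli_half prob_space_Bernoulli_half)

lemma prod_kernel:
  assumes "\<And>i. i < length v \<Longrightarrow> v ! i \<noteq> (False, True)"
  shows "prod_list (map kernel v) = (1/2) ^ card {i. i < length v \<and> fst (v ! i)}"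
proof -
  have "prod_list (map kernel v) = (\<Prod>i<length v. kernel (v ! i))"
    by (simp add: prod.list_conv_set_nth atLeast0LessThan)
  also have "\<dots> = (\<Prod>i<length v. if fst (v ! i) then 1/2 else 1)"
  proof (intro prod.cong refl)
    fix i assume "i \<in> {..<length v}"
    then show "kernel (v ! i) = (if fst (v ! i) then 1/2 else 1)"
      using assms[of i] by (cases "v ! i") (auto simp: kernel_def)
  qed
  also have "\<dots> = (\<Prod>i\<in>{i \<in> {..<length v}. fst (v ! i)}. 1/2)"
    by (rule prod.inter_filter[symmetric]) simp
  finally show ?thesis by simp
qed

context
  fixes \<nu> assumes \<nu>: "\<nu> \<in> inv_meas UNIV"
begin

interpretation coin: prob_space Bernoulli_half
  by (rule prob_space_Bernoulli_half)

lemma sets_product: "sets (\<nu> \<Otimes>\<^sub>M Bernoulli_half) = sets (Omega \<Otimes>\<^sub>M Omega)"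
  by (intro sets_pair_measure_cong inv_measD[OF \<nu>] sets_Bernoulli_half)

lemma product_inv_meas2: "\<nu> \<Otimes>\<^sub>M Bernoulli_half \<in> inv_meas2"
proof -
  interpret \<nu>: prob_space \<nu> by (rule inv_measD[OF \<nu>])
  interpret pair_prob_space \<nu> Bernoulli_half ..
  have "distr \<nu> Omega shift \<Otimes>\<^sub>M distr Bernoulli_half Omega shift
      = distr (\<nu> \<Otimes>\<^sub>M Bernoulli_half) (Omega \<Otimes>\<^sub>M Omega) (\<lambda>(x, y). (shift x, shift y))"
  proof (rule pair_measure_distr)
    show "shift \<in> measurable \<nu> Omega" "shift \<in> measurable Bernoulli_half Omega"
      using measurable_shift
      by (simp_all only: measurable_cong_sets[OF sets_Bernoulli_half refl]
          measurable_cong_sets[OF inv_measD(1)[OF \<nu>] refl])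
    show "sigma_finite_measure (distr Bernoulli_half Omega shift)"
      unfolding shift_Bernoulli_half by unfold_locales
  qed
  then show ?thesis
    using prob_space_axioms inv_measD(4)[OF \<nu>]
    by (simp add: inv_meas2_def sets_product shift_Bernoulli_half map_prod_def)
qed

lemma product_fst: "distr (\<nu> \<Otimes>\<^sub>M Bernoulli_half) Omega fst = \<nu>"
proof -
  interpret \<nu>: prob_space \<nu> by (rule inv_measD[OF \<nu>])
  have "distr (\<nu> \<Otimes>\<^sub>M Bernoulli_half) Omega fst = distr (\<nu> \<Otimes>\<^sub>M Bernoulli_half) \<nu> fst"
    by (rule distr_cong) (simp_all add: inv_measD[OF \<nu>])
  then show ?thesis by (simp add: coin.distr_pair_fst)
qed

lemma product_pair_prob:
  "pair_prob (\<nu> \<Otimes>\<^sub>M Bernoulli_half) v = word_prob \<nu> (map fst v) * prod_list (map kernel v)"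
proof (cases "\<exists>i<length v. v ! i = (False, True)")
  case True
  then obtain i where i: "i < length v" "v ! i = (False, True)" by blast
  then have "{z. \<forall>i<length v. (fst z (int i), Mult z (int i)) = v ! i} = {}"
    by (auto simp: Mult_def)
  moreover have "(False, True) \<in> set v" using i by (metis nth_mem)
  then have "kernel (False, True) \<in> set (map kernel v)" by (metis image_eqI set_map)
  then have "prod_list (map kernel v) = 0" by (auto simp: prod_list_zero_iff kernel_def)
  ultimately show ?thesis by (simp only: pair_prob_eq[OF product_inv_meas2] measure_empty mult_zero_right)
next
  case False
  \<comment> \<open>The positions where x is 1; only there does the pair word constrain y, so the
    event is a cylinder in x times a box in y.\<close>
  let ?J = "int ` {i. i < length v \<and> fst (v ! i)}"
  let ?E = "{y :: config. \<forall>i\<in>?J. y i = snd (v ! nat i)}"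
  have E: "?E \<in> sets Bernoulli_half"
  proof -
    have "{y \<in> space Omega. \<forall>i\<in>?J. y i = snd (v ! nat i)} \<in> sets Omega" by measurable
    then show ?thesis by (simp add: sets_Bernoulli_half)
  qed
  have "{z. \<forall>i<length v. (fst z (int i), Mult z (int i)) = v ! i} = cyl (map fst v) \<times> ?E"
  proof (intro set_eqI)
    fix z :: "config \<times> config"
    have "(fst z (int i), Mult z (int i)) = v ! i \<longleftrightarrow>
        fst z (int i) = fst (v ! i) \<and> (fst (v ! i) \<longrightarrow> snd z (int i) = snd (v ! i))"
      if "i < length v" for i
      using False that by (cases "v ! i") (auto simp: Mult_def)
    then show "z \<in> {z. \<forall>i<length v. (fst z (int i), Mult z (int i)) = v ! i} \<longleftrightarrow> z \<in> cyl (map fst v) \<times> ?E"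
      by (cases z) (auto simp: cyl_def)
  qed
  then have "pair_prob (\<nu> \<Otimes>\<^sub>M Bernoulli_half) v = measure (\<nu> \<Otimes>\<^sub>M Bernoulli_half) (cyl (map fst v) \<times> ?E)"
    using pair_prob_eq[OF product_inv_meas2, of v] by simp
  also have "\<dots> = measure \<nu> (cyl (map fst v)) * measure Bernoulli_half ?E"
    using E by (simp add: measure_def coin.emeasure_pair_measure_Times inv_measD[OF \<nu>] enn2real_mult)
  also have "measure Bernoulli_half ?E = (1/2) ^ card ?J"
    by (rule Bernoulli_half_box) simp
  also have "card ?J = card {i. i < length v \<and> fst (v ! i)}"
    by (rule card_image) simp
  also have "(1/2) ^ \<dots> = prod_list (map kernel v)"
    using False by (intro prod_kernel[symmetric]) auto
  finally show ?thesis by (simp add: word_prob_def)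
qed

text \<open>For the product, H(x, z) = H(x) + n \<nu>(1) exactly, while H(x, z) \<le> H(x) + H(z);
  cancelling H(x) leaves a bound valid for every length.\<close>

lemma product_entropy_ge:
  "real n * measure \<nu> {x. x 0}
   \<le> word_entropy (word_prob (distr (\<nu> \<Otimes>\<^sub>M Bernoulli_half) Omega Mult)) n"
proof -
  let ?L = "\<nu> \<Otimes>\<^sub>M Bernoulli_half"
  interpret stationary "pair_prob ?L"
    by (rule stationary_pair_prob[OF product_inv_meas2])
  have "inj (\<lambda>a :: bool \<times> bool. (fst a, snd a))" by (auto intro: injI)
  from entropy_le_factors[OF this, of n]
  have "word_entropy (pair_prob ?L) n \<le> word_entropy (word_prob \<nu>) n
      + word_entropy (word_prob (distr ?L Omega Mult)) n"
    by (simp add: factor_pair_prob[OF product_inv_meas2] product_fst)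
  then show ?thesis
    using pair_entropy_kernel[OF product_inv_meas2 product_fst product_pair_prob, of n] by simp
qed

end

section \<open>Weak limits of measures on the full shift\<close>

text \<open>The point of the middle-thirds Cantor set with ternary digits 0 and 2; the gap (1/3,
  2/3) is what allows a continuous function to read the first digit.\<close>

definition cantor :: "(nat \<Rightarrow> bool) \<Rightarrow> real" where
  "cantor b = (\<Sum>k. 2 * of_bool (b k) / 3 ^ Suc k)"

definition lead_digit :: "real \<Rightarrow> real" where
  "lead_digit t = min 1 (max 0 (3 * t - 1))"

text \<open>The iterated map deletes the leading ternary digit and rescales, so on codes it acts as
  the shift of the digit sequence, yet it is continuous on the whole line.\<close>

definition digit :: "nat \<Rightarrow> real \<Rightarrow> real" where
  "digit k t = lead_digit (((\<lambda>t. 3 * t - 2 * lead_digit t) ^^ k) t)"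

lemma cantor_summable: "summable (\<lambda>k. 2 * of_bool (b k) / 3 ^ Suc k :: real)"
proof (rule summable_comparison_test')
  show "summable (\<lambda>k. 2 / 3 * (1 / 3) ^ k :: real)"
    by (intro summable_mult summable_geometric) simp
  show "norm (2 * of_bool (b k) / 3 ^ Suc k :: real) \<le> 2 / 3 * (1 / 3) ^ k" if "0 \<le> k" for k
    by (simp add: power_divide)
qed

lemma cantor_bounds: "0 \<le> cantor b" "cantor b \<le> 1"
proof -
  show "0 \<le> cantor b" unfolding cantor_def by (intro suminf_nonneg cantor_summable) simp
  have "cantor b \<le> (\<Sum>k. 2 / 3 * (1 / 3) ^ k)"
    unfolding cantor_def
    by (intro suminf_le cantor_summable summable_mult summable_geometric) (simp_all add: power_divide)
  also have "\<dots> = 2 / 3 * (\<Sum>k. (1 / 3) ^ k)"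
    by (intro suminf_mult summable_geometric) simp
  also have "\<dots> = 1" by (simp add: suminf_geometric)
  finally show "cantor b \<le> 1" .
qed

lemma cantor_Suc: "cantor b = 2 * of_bool (b 0) / 3 + cantor (\<lambda>k. b (Suc k)) / 3"
proof -
  have "cantor b = (\<Sum>k. 2 * of_bool (b (Suc k)) / 3 ^ Suc (Suc k)) + 2 * of_bool (b 0) / 3"
    unfolding cantor_def using suminf_split_head[OF cantor_summable[of b]] by simp
  also have "(\<Sum>k. 2 * of_bool (b (Suc k)) / 3 ^ Suc (Suc k))
      = (\<Sum>k. (2 * of_bool (b (Suc k)) / 3 ^ Suc k) / 3 :: real)"
    by (simp add: field_simps)
  also have "\<dots> = cantor (\<lambda>k. b (Suc k)) / 3"
    unfolding cantor_def by (rule suminf_divide[OF cantor_summable[of "\<lambda>k. b (Suc k)"]])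
  finally show ?thesis by simp
qed

lemma lead_digit_cantor: "lead_digit (cantor b) = of_bool (b 0)"
proof (cases "b 0")
  case True
  then have "2 / 3 \<le> cantor b"
    using cantor_bounds[of "\<lambda>k. b (Suc k)"] by (subst cantor_Suc) simp
  then show ?thesis using True by (simp add: lead_digit_def)
next
  case False
  then have "cantor b \<le> 1 / 3"
    using cantor_bounds[of "\<lambda>k. b (Suc k)"] by (subst cantor_Suc) simp
  then show ?thesis using False by (simp add: lead_digit_def)
qed

lemma digit_cantor: "digit k (cantor b) = of_bool (b k)"
proof (induction k arbitrary: b)
  case 0
  show ?case by (simp add: digit_def lead_digit_cantor)
next
  case (Suc k)
  have "3 * cantor b - 2 * lead_digit (cantor b) = cantor (\<lambda>k. b (Suc k))"
    unfolding lead_digit_cantor by (subst cantor_Suc) simp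
  then have "digit (Suc k) (cantor b) = digit k (cantor (\<lambda>k. b (Suc k)))"
    by (simp add: digit_def funpow_Suc_right del: funpow.simps)
  then show ?case using Suc by simp
qed

lemma digit_bounds: "0 \<le> digit k t" "digit k t \<le> 1"
  by (simp_all add: digit_def lead_digit_def)

lemma continuous_digit: "continuous_on UNIV (digit k)"
proof -
  have lead: "continuous_on UNIV lead_digit"
    unfolding lead_digit_def[abs_def] by (intro continuous_intros)
  have "continuous_on UNIV ((\<lambda>t. 3 * t - 2 * lead_digit t) ^^ k)"
  proof (induction k)
    case (Suc k)
    have "continuous_on UNIV (\<lambda>t. 3 * t - 2 * lead_digit t)"
      by (intro continuous_intros lead)
    from continuous_on_compose2[OF this Suc] show ?case by simp
  qed (simp add: id_def)
  from continuous_on_compose2[OF lead this] show ?thesis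
    by (simp add: digit_def[abs_def])
qed

lemma measurable_digit [measurable]: "digit k \<in> borel_measurable borel"
  by (rule borel_measurable_continuous_onI[OF continuous_digit])

text \<open>Helly's selection theorem for the images under the Cantor code: the decoding maps \<open>digit\<close>
  are continuous on the whole line, so they commute with weak limits.\<close>
lemma config_measure_limit:
  fixes P :: "nat \<Rightarrow> config pmf"
  obtains r :: "nat \<Rightarrow> nat" and M :: "config measure"
  where "strict_mono r" "sets M = sets Omega" "prob_space M"
    "\<And>J v. finite J \<Longrightarrow> (\<lambda>n. measure_pmf.prob (P (r n)) {x. \<forall>i\<in>J. x i = v i})
        \<longlonglongrightarrow> measure M {x. \<forall>i\<in>J. x i = v i}"
proof -
  \<comment> \<open>The bijection \<open>int_decode\<close> lists the integer coordinates as a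
    sequence of digits.\<close>
  define c :: "config \<Rightarrow> real" where "c x = cantor (\<lambda>k. x (int_decode k))" for x
  define D where "D n = distr (measure_pmf (P n)) borel c" for n
  have D: "real_distribution (D n)" for n
    unfolding D_def real_distribution_def real_distribution_axioms_def
    by (auto intro: measure_pmf.prob_space_distr)
  have "measure (D n) {- 1<..1} = 1" for n
  proof -
    have "- 1 < cantor b" for b using cantor_bounds(1)[of b] by linarith
    then have "c -` {- 1<..1} = UNIV"
      using cantor_bounds(2) by (auto simp: c_def)
    then show ?thesis by (simp add: D_def measure_distr)
  qed
  then have "tight D"
    unfolding tight_def using D
    by (intro conjI allI impI) (blast, rule exI[of _ "- 1"], rule exI[of _ 1], simp)
  then obtain r M where r: "strict_mono r" and M: "real_distribution M" and "weak_conv_m (D \<circ> id \<circ> r) M"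
    using tight_imp_convergent_subsubsequence[of D id] by (auto simp: strict_mono_def)
  then have conv: "weak_conv_m (\<lambda>n. D (r n)) M" by (simp add: comp_def)
  interpret M: real_distribution M by fact
  have lim: "(\<lambda>n. measure_pmf.expectation (P (r n)) (\<lambda>x. f (c x))) \<longlonglongrightarrow> integral\<^sup>L M f"
    if "continuous_on UNIV f" "\<And>t. \<bar>f t\<bar> \<le> B" for f :: "real \<Rightarrow> real" and B
  proof -
    have "(\<lambda>n. integral\<^sup>L (D (r n)) f) \<longlonglongrightarrow> integral\<^sup>L M f"
      by (rule weak_conv_imp_integral_bdd_continuous_conv[OF D M conv, of f B])
         (use that in \<open>auto simp: continuous_on_eq_continuous_at\<close>)
    moreover have "integral\<^sup>L (D n) f = measure_pmf.expectation (P n) (\<lambda>x. f (c x))" for n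
      unfolding D_def using borel_measurable_continuous_onI[OF that(1)] by (simp add: integral_distr)
    ultimately show ?thesis by simp
  qed
  \<comment> \<open>A continuous function on the line that equals the indicator of
    \<open>x i = a\<close> at the code of \<open>x\<close>.\<close>
  define F :: "int \<Rightarrow> bool \<Rightarrow> real \<Rightarrow> real" where
    "F i a t = (if a then digit (int_encode i) t else 1 - digit (int_encode i) t)" for i a t
  have Fc: "continuous_on UNIV (F i a)" for i a
    unfolding F_def by (cases a) (auto intro!: continuous_intros continuous_digit)
  have Fb: "0 \<le> F i a t" "F i a t \<le> 1" for i a t
    using digit_bounds by (auto simp: F_def)
  have Fcode: "F i a (c x) = of_bool (x i = a)" for i a x
    by (auto simp: F_def c_def digit_cantor)
  have [measurable]: "F i a \<in> borel_measurable borel" for i a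
    by (rule borel_measurable_continuous_onI[OF Fc])
  \<comment> \<open>The limit could a priori charge points that are not codes. The product is
    continuous and vanishes at all codes, so its integral passes to the limit as 0: almost surely
    every digit is exactly 0 or 1.\<close>
  have "AE t in M. F i True t * F i False t = 0" for i
  proof -
    have b: "\<bar>F i True t * F i False t\<bar> \<le> 1" for t
      using Fb[of i True t] Fb[of i False t] by (simp add: abs_mult mult_le_one)
    have "(\<lambda>n. measure_pmf.expectation (P (r n)) (\<lambda>x. F i True (c x) * F i False (c x)))
        \<longlonglongrightarrow> integral\<^sup>L M (\<lambda>t. F i True t * F i False t)"
      by (rule lim[of _ 1]) (auto intro!: continuous_on_mult Fc b)
    moreover have "F i True (c x) * F i False (c x) = 0" for x
      by (simp add: Fcode)
    ultimately have "(\<lambda>n :: nat. 0 :: real) \<longlonglongrightarrow> integral\<^sup>L M (\<lambda>t. F i True t * F i False t)"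
      by simp
    then have "integral\<^sup>L M (\<lambda>t. F i True t * F i False t) = 0"
      using LIMSEQ_unique tendsto_const by blast
    moreover have "integrable M (\<lambda>t. F i True t * F i False t)"
      by (rule M.integrable_const_bound[of _ 1]) (use b in auto)
    ultimately show ?thesis
      using Fb by (subst (asm) integral_nonneg_eq_0_iff_AE) auto
  qed
  then have AE: "AE t in M. \<forall>i. F i True t * F i False t = 0"
    by (simp add: AE_all_countable)
  \<comment> \<open>The threshold matters only on a null set, as the digits are almost surely 0 or
    1.\<close>
  define d :: "real \<Rightarrow> config" where "d t i \<longleftrightarrow> digit (int_encode i) t > 1/2" for t i
  have d: "d \<in> measurable M Omega"
    by (rule measurable_into_Omega) (simp add: d_def)
  have Fd: "F i a t = of_bool (d t i = a)" if "F i True t * F i False t = 0" for i a t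
    using that by (auto simp: F_def d_def)
  show ?thesis
  proof (rule that[OF r])
    show "sets (distr M Omega d) = sets Omega" by simp
    show "prob_space (distr M Omega d)" by (rule M.prob_space_distr[OF d])
    fix J :: "int set" and v :: config assume J: "finite J"
    let ?B = "{x :: config. \<forall>i\<in>J. x i = v i}"
    have "{x \<in> space Omega. \<forall>i\<in>J. x i = v i} \<in> sets Omega"
      using J by measurable
    then have B: "?B \<in> sets Omega" by simp
    have prod: "(\<Prod>i\<in>J. of_bool (x i = v i)) = (indicator ?B x :: real)" for x
    proof (cases "x \<in> ?B")
      case False
      then obtain i where "i \<in> J" "x i \<noteq> v i" by blast
      then have "(\<Prod>i\<in>J. of_bool (x i = v i)) = (0 :: real)"
        using J by (intro prod_zero) auto
      then show ?thesis using False by simp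
    qed (auto simp: indicator_def)
    have b: "\<bar>\<Prod>i\<in>J. F i (v i) t\<bar> \<le> 1" for t
      using Fb by (simp add: abs_prod prod_le_1)
    have "(\<lambda>n. measure_pmf.expectation (P (r n)) (\<lambda>x. \<Prod>i\<in>J. F i (v i) (c x)))
        \<longlonglongrightarrow> integral\<^sup>L M (\<lambda>t. \<Prod>i\<in>J. F i (v i) t)"
      by (rule lim[of _ 1]) (auto intro!: continuous_on_prod Fc b)
    moreover have "measure_pmf.expectation (P n) (\<lambda>x. \<Prod>i\<in>J. F i (v i) (c x)) = measure_pmf.prob (P n) ?B" for n
      by (simp add: Fcode prod)
    moreover have "integral\<^sup>L M (\<lambda>t. \<Prod>i\<in>J. F i (v i) t) = measure (distr M Omega d) ?B"
    proof -
      have "integral\<^sup>L M (\<lambda>t. \<Prod>i\<in>J. F i (v i) t) = integral\<^sup>L M (\<lambda>t. indicator ?B (d t))"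
      proof (rule integral_cong_AE)
        show "AE t in M. (\<Prod>i\<in>J. F i (v i) t) = indicator ?B (d t)"
          using AE
        proof eventually_elim
          case (elim t)
          then have "F i (v i) t = of_bool (d t i = v i)" for i by (intro Fd) blast
          then show ?case by (simp only: prod)
        qed
        show "(\<lambda>t. indicator ?B (d t)) \<in> borel_measurable M"
          by (rule measurable_compose[OF _ borel_measurable_indicator[OF B]]) (rule d)
      qed measurable
      also have "\<dots> = integral\<^sup>L (distr M Omega d) (indicator ?B)"
        by (rule integral_distr[OF d borel_measurable_indicator[OF B], symmetric])
      also have "\<dots> = measure (distr M Omega d) ?B"
        using B by simp
      finally show ?thesis .
    qed
    ultimately show "(\<lambda>n. measure_pmf.prob (P (r n)) ?B) \<longlonglongrightarrow> measure (distr M Omega d) ?B" by simp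
  qed
qed

section \<open>Topological entropy\<close>

definition word :: "nat \<Rightarrow> config \<Rightarrow> bool list" where
  "word n x = map (\<lambda>i. x (int i)) [0..<n]"

lemma length_word [simp]: "length (word n x) = n"
  by (simp add: word_def)

lemma words_eq: "words X n = word n ` X"
  by (simp add: words_def word_def[abs_def])

lemma finite_words: "finite (words X n)"
  by (rule finite_subset[OF _ finite_wordsn[of n]]) (auto simp: words_eq)

lemma in_cyl_iff: "x \<in> cyl u \<longleftrightarrow> word (length u) x = u"
  unfolding cyl_def word_def by (subst list_eq_iff_nth_eq) simp

lemma cyl_box: "cyl u = {x. \<forall>i\<in>int ` {..<length u}. x i = u ! nat i}"
  by (auto simp: cyl_def)

text \<open>Gibbs' inequality against the uniform law on \<open>S\<close>.\<close>

lemma entropy_le_log_card: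
  assumes "stationary p" and S: "finite S" "S \<subseteq> wordsn n" and supp: "\<And>w. length w = n \<Longrightarrow> w \<notin> S \<Longrightarrow> p w = 0"
  shows "word_entropy p n \<le> log 2 (real (card S))"
proof -
  interpret stationary p by fact
  have s1: "sum p S = 1"
    using sum.mono_neutral_left[OF finite_wordsn S(2), of p] supp sum_words[of n] by auto
  then have "S \<noteq> {}" by auto
  then have card: "real (card S) > 0" using S(1) by (simp add: card_gt_0_iff)
  have "(\<Sum>w\<in>S. p w * log 2 (1 / real (card S))) \<le> (\<Sum>w\<in>S. p w * log 2 (p w))"
    by (rule gibbs_inequality(1)[OF S(1) nonneg _ _ s1]) (use card in auto)
  also have "(\<Sum>w\<in>S. p w * log 2 (p w)) = (\<Sum>w\<in>wordsn n. p w * log 2 (p w))"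
    by (rule sum.mono_neutral_left[OF finite_wordsn S(2)]) (use supp in auto)
  also have "(\<Sum>w\<in>S. p w * log 2 (1 / real (card S))) = - log 2 (real (card S))"
    by (simp only: sum_distrib_right[symmetric] s1) (use card in \<open>simp add: log_divide\<close>)
  finally show ?thesis by (simp add: word_entropy_def)
qed

lemma entropy_le_words:
  assumes \<mu>: "\<mu> \<in> inv_meas X"
  shows "word_entropy (word_prob \<mu>) n \<le> log 2 (real (card (words X n)))"
proof (rule entropy_le_log_card[OF stationary_word_prob[OF \<mu>] finite_words])
  show "words X n \<subseteq> wordsn n" by (auto simp: words_eq)
  fix w :: "bool list" assume w: "length w = n" "w \<notin> words X n"
  note i = inv_measD[OF \<mu>]
  interpret prob_space \<mu> by (rule i)
  \<comment> \<open>A non-measurable set has \<open>emeasure\<close> 0, so measure 1 implies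
    measurability.\<close>
  have X: "X \<in> sets \<mu>" using i(5) emeasure_notin_sets by fastforce
  have "cyl w \<inter> X = {}"
  proof (rule ccontr)
    assume "cyl w \<inter> X \<noteq> {}"
    then obtain x where "x \<in> X" "word n x = w" using w(1) by (auto simp: in_cyl_iff)
    then show False using w(2) by (auto simp: words_eq)
  qed
  then have "measure \<mu> (cyl w \<union> X) = measure \<mu> (cyl w) + measure \<mu> X"
    using X i(1) by (intro finite_measure_Union) auto
  moreover have "measure \<mu> X = 1" using i(5) by (simp add: measure_def)
  ultimately show "word_prob \<mu> w = 0"
    using prob_le_1[of "cyl w \<union> X"] measure_nonneg[of \<mu> "cyl w"] by (simp add: word_prob_def)
qed

text \<open>Gibbs' inequality for the uniform law on \<open>W\<close> against a Markov chain of order \<open>k\<close> with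
  transition probabilities \<open>q\<close>.\<close>
lemma log_card_le_markov:
  fixes q :: "bool list \<Rightarrow> real"
  assumes W: "W \<subseteq> wordsn n" "W \<noteq> {}" and q: "\<And>v. 0 < q v"
    and sum: "\<And>v. length v = k \<Longrightarrow> (\<Sum>a\<in>UNIV. q (v @ [a])) \<le> 1"
  shows "log 2 (real (card W))
    \<le> real k + (\<Sum>w\<in>W. \<Sum>j<n - k. - log 2 (q (take (Suc k) (drop j w)))) / real (card W)"
proof -
  let ?R = "\<lambda>w. \<Prod>j<n - k. q (take (Suc k) (drop j w))"
  have fin: "finite W" using W(1) finite_wordsn by (rule finite_subset)
  then have card: "real (card W) > 0" using W(2) by (simp add: card_gt_0_iff)
  have R: "?R w > 0" for w by (intro prod_pos) (simp add: q)
  have log_prod: "log 2 (\<Prod>j<m. f j) = (\<Sum>j<m. log 2 (f j))"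
    if "\<And>j. 0 < f j" for f :: "nat \<Rightarrow> real" and m
    by (induction m) (simp_all add: log_mult_pos prod_pos that)
  have "sum ?R W \<le> (\<Sum>w\<in>wordsn n. ?R w)"
    using R by (intro sum_mono2 W) (auto intro: less_imp_le)
  also have "\<dots> \<le> real (CARD(bool) ^ k)"
    by (rule sum_markov_le) (use q sum in \<open>auto intro: less_imp_le\<close>)
  \<comment> \<open>The first \<open>k\<close> letters carry no weight in \<open>?R\<close>; the
    normalisation \<open>2 ^ k\<close> pays for them and becomes the additive
    \<open>real k\<close>.\<close>
  finally have "(\<Sum>w\<in>W. ?R w / 2 ^ k) \<le> 1"
    by (simp add: sum_divide_distrib[symmetric])
  then have "(\<Sum>w\<in>W. 1 / real (card W) * log 2 (?R w / 2 ^ k))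
      \<le> (\<Sum>w\<in>W. 1 / real (card W) * log 2 (1 / real (card W)))"
    by (intro gibbs_inequality(1) fin) (use card R in \<open>auto intro: less_imp_le divide_pos_pos\<close>)
  also have "\<dots> = - log 2 (real (card W))"
    using card by (simp add: log_divide)
  also have "(\<Sum>w\<in>W. 1 / real (card W) * log 2 (?R w / 2 ^ k))
      = (\<Sum>w\<in>W. \<Sum>j<n - k. log 2 (q (take (Suc k) (drop j w)))) / real (card W) - real k"
  proof -
    have "log 2 (?R w / 2 ^ k) = (\<Sum>j<n - k. log 2 (q (take (Suc k) (drop j w)))) - real k" for w
      using R[of w] by (simp add: log_divide_pos log_nat_power log_prod q)
    then show ?thesis
      using card by (simp add: sum_subtractf diff_divide_distrib sum_divide_distrib)
  qed
  finally show ?thesis by (simp add: sum_negf)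
qed

text \<open>The empirical measure: a word \<open>w\<close> of \<open>W\<close> and a time below
  \<open>m\<close> are drawn uniformly, and the point \<open>\<rho> w\<close> is shifted by that
  time.\<close>

definition orbit_pmf :: "(bool list \<Rightarrow> config) \<Rightarrow> bool list set \<Rightarrow> nat \<Rightarrow> config pmf" where
  "orbit_pmf \<rho> W m = map_pmf (\<lambda>(w, j). \<lambda>i. \<rho> w (i + int j)) (pmf_of_set (W \<times> {..<m}))"

lemma prob_orbit_pmf:
  assumes "finite W" "W \<noteq> {}" "m > 0"
  shows "measure_pmf.prob (orbit_pmf \<rho> W m) {x. Q x}
    = (\<Sum>w\<in>W. \<Sum>j<m. of_bool (Q (\<lambda>i. \<rho> w (i + int j)))) / (real (card W) * real m)"
proof -
  let ?S = "W \<times> {..<m}"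
  have S: "?S \<noteq> {}" "finite ?S" using assms by auto
  have "measure_pmf.prob (orbit_pmf \<rho> W m) {x. Q x}
      = real (card (?S \<inter> {z. Q (\<lambda>i. \<rho> (fst z) (i + int (snd z)))})) / real (card ?S)"
    unfolding orbit_pmf_def by (simp add: measure_pmf_of_set[OF S] vimage_def case_prod_unfold)
  also have "real (card (?S \<inter> {z. Q (\<lambda>i. \<rho> (fst z) (i + int (snd z)))}))
      = (\<Sum>z\<in>?S. of_bool (Q (\<lambda>i. \<rho> (fst z) (i + int (snd z)))))"
    using S(2) by (simp add: sum_of_bool_eq)
  also have "\<dots> = (\<Sum>w\<in>W. \<Sum>j<m. of_bool (Q (\<lambda>i. \<rho> w (i + int j))))"
    by (simp only: sum.cartesian_product case_prod_unfold)
  finally show ?thesis by (simp only: card_cartesian_product card_lessThan of_nat_mult)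
qed

lemma subshift_orbit:
  assumes "subshift X" "x \<in> X"
  shows "(\<lambda>i. x (i + int j)) \<in> X"
proof (induction j)
  case (Suc j)
  then have "shift (\<lambda>i. x (i + int j)) \<in> X" using assms(1) by (auto simp: subshift_def)
  then show ?case by (simp add: shift_def add_ac)
qed (simp add: assms)

section \<open>Limits of empirical measures along the words of \<open>X\<close>\<close>

context
  fixes X :: "config set" and \<rho> :: "nat \<Rightarrow> bool list \<Rightarrow> config" and s :: "nat \<Rightarrow> nat" and M :: "config measure"
  assumes X: "subshift X" "X \<noteq> {}"
    and \<rho>: "\<And>n w. w \<in> words X n \<Longrightarrow> \<rho> n w \<in> X \<and> word n (\<rho> n w) = w"
    and s: "\<And>n. n < s n"
    and M: "sets M = sets Omega" "prob_space M"
    and lim: "\<And>J v. finite J \<Longrightarrow>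
      (\<lambda>n. measure_pmf.prob (orbit_pmf (\<rho> (s n)) (words X (s n)) (s n)) {x. \<forall>i\<in>J. x i = v i})
        \<longlonglongrightarrow> measure M {x. \<forall>i\<in>J. x i = v i}"
begin

private abbreviation "P n \<equiv> orbit_pmf (\<rho> (s n)) (words X (s n)) (s n)"

lemma words_nonempty: "words X n \<noteq> {}"
  using X(2) by (simp add: words_eq)

lemma s_pos: "s n > 0"
  using s[of n] by simp

lemma prob_P: "measure_pmf.prob (P n) {x. Q x}
    = (\<Sum>w\<in>words X (s n). \<Sum>j<s n. of_bool (Q (\<lambda>i. \<rho> (s n) w (i + int j))))
      / (real (card (words X (s n))) * real (s n))"
  by (rule prob_orbit_pmf[OF finite_words words_nonempty s_pos])

lemma space_M: "space M = UNIV"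
  using sets_eq_imp_space_eq[OF M(1)] by simp

interpretation M: prob_space M by (rule M)

lemma box_sets: "finite J \<Longrightarrow> {x. \<forall>i\<in>J. x i = v i} \<in> sets Omega"
proof -
  assume J: "finite J"
  have "{x \<in> space Omega. \<forall>i\<in>J. x i = v i} \<in> sets Omega"
    using J by measurable
  then show ?thesis by simp
qed

text \<open>For each word the sum over times telescopes to the two end times, a difference of at
  most 1 among \<open>s n\<close> terms.\<close>

lemma prob_shift_diff:
  "\<bar>measure_pmf.prob (P n) {x. Q (shift x)} - measure_pmf.prob (P n) {x. Q x}\<bar> \<le> 1 / real (s n)"
proof -
  let ?W = "words X (s n)" and ?o = "\<lambda>w j. of_bool (Q (\<lambda>i. \<rho> (s n) w (i + int j))) :: real"
  have card: "real (card ?W) > 0"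
    using finite_words words_nonempty by (simp add: card_gt_0_iff)
  have shift: "shift (\<lambda>i. \<rho> (s n) w (i + int j)) = (\<lambda>i. \<rho> (s n) w (i + int (Suc j)))" for w j
    by (simp add: shift_def add_ac)
  have tel: "(\<Sum>j<s n. ?o w (Suc j) - ?o w j) = ?o w (s n) - ?o w 0" for w
    by (rule sum_lessThan_telescope)
  have "measure_pmf.prob (P n) {x. Q (shift x)} - measure_pmf.prob (P n) {x. Q x}
      = (\<Sum>w\<in>?W. \<Sum>j<s n. ?o w (Suc j) - ?o w j) / (real (card ?W) * real (s n))"
    unfolding prob_P shift by (simp add: diff_divide_distrib sum_subtractf)
  also have "\<dots> = (\<Sum>w\<in>?W. ?o w (s n) - ?o w 0) / (real (card ?W) * real (s n))"
    unfolding tel ..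
  also have "\<bar>\<dots>\<bar> \<le> (real (card ?W) * 1) / (real (card ?W) * real (s n))"
    unfolding abs_divide
  proof (intro divide_mono)
    have "\<bar>\<Sum>w\<in>?W. ?o w (s n) - ?o w 0\<bar> \<le> (\<Sum>w\<in>?W. \<bar>?o w (s n) - ?o w 0\<bar>)"
      by (rule sum_abs)
    also have "\<dots> \<le> (\<Sum>w\<in>?W. 1)" by (intro sum_mono) simp
    finally show "\<bar>\<Sum>w\<in>?W. ?o w (s n) - ?o w 0\<bar> \<le> real (card ?W) * 1" by simp
  qed (use card s_pos in auto)
  finally show ?thesis using card by simp
qed

lemma s_inverse_lim: "(\<lambda>n. 1 / real (s n)) \<longlonglongrightarrow> 0"
proof (rule real_tendsto_sandwich[OF _ _ tendsto_const lim_1_over_n])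
  show "\<forall>\<^sub>F n in sequentially. 1 / real (s n) \<le> 1 / real n"
    using eventually_gt_at_top[of 0]
  proof eventually_elim
    case (elim n)
    then show ?case using s[of n] by (intro divide_left_mono) auto
  qed
qed simp

lemma limit_invariant: "distr M Omega shift = M"
proof (rule Omega_eqI)
  have m: "shift \<in> measurable M Omega"
    using measurable_shift by (simp only: measurable_cong_sets[OF M(1) refl])
  then show "prob_space (distr M Omega shift)" by (rule M.prob_space_distr)
  fix n :: nat and v :: config
  let ?I = "{- int n..<int n}"
  let ?Q = "\<lambda>x :: config. \<forall>i\<in>?I. x i = v i"
  have J: "{x. ?Q (shift x)} = {x. \<forall>i\<in>(\<lambda>i. i + 1) ` ?I. x i = v (i - 1)}"
    by (simp only: shift_def ball_simps Ball_image_comp comp_def add_diff_cancel_right')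
  have "(\<lambda>n. measure_pmf.prob (P n) {x. ?Q (shift x)}) \<longlonglongrightarrow> measure M {x. ?Q (shift x)}"
    unfolding J by (rule lim) simp
  moreover have "(\<lambda>n. measure_pmf.prob (P n) {x. ?Q x}) \<longlonglongrightarrow> measure M {x. ?Q x}"
    by (rule lim) simp
  ultimately have "(\<lambda>n. measure_pmf.prob (P n) {x. ?Q (shift x)} - measure_pmf.prob (P n) {x. ?Q x})
      \<longlonglongrightarrow> measure M {x. ?Q (shift x)} - measure M {x. ?Q x}"
    by (rule tendsto_diff)
  moreover have "(\<lambda>n. measure_pmf.prob (P n) {x. ?Q (shift x)} - measure_pmf.prob (P n) {x. ?Q x}) \<longlonglongrightarrow> 0"
    by (rule Lim_null_comparison[OF always_eventually s_inverse_lim])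
       (simp only: real_norm_def, intro allI prob_shift_diff[of _ ?Q])
  ultimately have "measure M {x. ?Q (shift x)} = measure M {x. ?Q x}"
    using LIMSEQ_unique by fastforce
  moreover have "measure (distr M Omega shift) {x. ?Q x} = measure M {x. ?Q (shift x)}"
    by (subst measure_distr[OF m box_sets]) (simp_all add: vimage_def space_M)
  ultimately show "measure (distr M Omega shift) {x. ?Q x} = measure M {x. ?Q x}" by simp
qed (use M in auto)

text \<open>\<open>X\<close> is the intersection of the sets \<open>?A N\<close> of points agreeing
  with some point of \<open>X\<close> on a window. The orbits defining \<open>P n\<close> stay in
  \<open>X\<close>, so each box in the complement of \<open>?A N\<close> has probability 0 before,
  hence also after, the limit.\<close>

lemma limit_support: "emeasure M X = 1"
proof -
  let ?A = "\<lambda>N :: nat. {x. \<exists>y\<in>X. \<forall>i. \<bar>i\<bar> \<le> int N \<longrightarrow> y i = x i}"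
  have A: "?A N \<in> sets M \<and> (AE x in M. x \<in> ?A N)" for N
  proof -
    let ?I = "{- int N..int N}"
    let ?V = "{v. v \<notin> ?A N \<and> (\<forall>i. i \<notin> ?I \<longrightarrow> \<not> v i)}"
    let ?B = "\<lambda>v. {x :: config. \<forall>i\<in>?I. x i = v i}"
    have "?V \<subseteq> (\<lambda>F i. i \<in> F) ` Pow ?I"
    proof
      fix v assume "v \<in> ?V"
      then show "v \<in> (\<lambda>F i. i \<in> F) ` Pow ?I" by (intro image_eqI[of _ _ "{i. v i}"]) auto
    qed
    then have fin: "finite ?V" by (rule finite_subset) auto
    have null: "?B v \<in> null_sets M" if v: "v \<in> ?V" for v
    proof -
      have "measure_pmf.prob (P n) (?B v) = 0" for n
      proof -
        have "\<not> (\<forall>i\<in>?I. \<rho> (s n) w (i + int j) = v i)" if w: "w \<in> words X (s n)" for w j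
        proof
          assume eq: "\<forall>i\<in>?I. \<rho> (s n) w (i + int j) = v i"
          have "(\<lambda>i. \<rho> (s n) w (i + int j)) \<in> X"
            using \<rho>[OF w] by (intro subshift_orbit X) simp
          moreover have "\<forall>i. \<bar>i\<bar> \<le> int N \<longrightarrow> \<rho> (s n) w (i + int j) = v i"
            using eq by (auto simp: abs_le_iff)
          ultimately have "v \<in> ?A N" by (intro CollectI bexI)
          then show False using v by blast
        qed
        then have "(\<Sum>w\<in>words X (s n). \<Sum>j<s n. of_bool (\<forall>i\<in>?I. \<rho> (s n) w (i + int j) = v i)) = (0 :: real)"
          by (intro sum.neutral ballI) (simp only: of_bool_eq_0_iff not_False_eq_True)
        then show ?thesis unfolding prob_P by (simp only: div_0)
      qed
      then have "(\<lambda>n. 0) \<longlonglongrightarrow> measure M (?B v)"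
        using lim[of ?I v] by simp
      then have "measure M (?B v) = 0" using LIMSEQ_unique tendsto_const by blast
      then show ?thesis
        using box_sets[of ?I v] M(1) by (auto simp: null_sets_def M.emeasure_eq_measure)
    qed
    have compl: "UNIV - ?A N = (\<Union>v\<in>?V. ?B v)"
    proof (intro equalityI subsetI)
      fix x assume x: "x \<in> UNIV - ?A N"
      have "(\<lambda>i. i \<in> ?I \<and> x i) \<notin> ?A N"
      proof
        assume "(\<lambda>i. i \<in> ?I \<and> x i) \<in> ?A N"
        then obtain y where y: "y \<in> X" "\<And>i. \<bar>i\<bar> \<le> int N \<Longrightarrow> y i = (i \<in> ?I \<and> x i)" by blast
        have "y i = x i" if "\<bar>i\<bar> \<le> int N" for i
          using y(2)[OF that] that by (auto simp: abs_le_iff)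
        then show False using x y(1) by blast
      qed
      then show "x \<in> (\<Union>v\<in>?V. ?B v)"
        by (intro UN_I[of "\<lambda>i. i \<in> ?I \<and> x i"]) auto
    next
      fix x assume "x \<in> (\<Union>v\<in>?V. ?B v)"
      then obtain v where v: "v \<notin> ?A N" "\<And>i. i \<in> ?I \<Longrightarrow> x i = v i" by blast
      have "x \<notin> ?A N"
      proof
        assume "x \<in> ?A N"
        then obtain y where y: "y \<in> X" "\<And>i. \<bar>i\<bar> \<le> int N \<Longrightarrow> y i = x i" by blast
        have "y i = v i" if "\<bar>i\<bar> \<le> int N" for i
          using y(2)[OF that] v(2)[of i] that by (auto simp: abs_le_iff)
        then show False using v(1) y(1) by blast
      qed
      then show "x \<in> UNIV - ?A N" by blast
    qed
    have nullc: "UNIV - ?A N \<in> null_sets M"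
      unfolding compl by (rule null_sets_UN'[OF countable_finite[OF fin]]) (rule null)
    have "space M - (UNIV - ?A N) \<in> sets M" using nullc by blast
    moreover have "space M - (UNIV - ?A N) = ?A N" by (auto simp: space_M)
    ultimately have "?A N \<in> sets M" by simp
    moreover have "AE x in M. x \<in> ?A N"
      by (rule AE_I'[OF nullc]) (auto simp: space_M)
    ultimately show ?thesis by blast
  qed
  have XA: "X = (\<Inter>N. ?A N)"
  proof (intro equalityI subsetI)
    fix x assume "x \<in> (\<Inter>N. ?A N)"
    then show "x \<in> X" using X(1) by (auto simp: subshift_def shift_closed_def)
  qed auto
  have "AE x in M. \<forall>N. x \<in> ?A N" using A by (subst AE_all_countable) blast
  then have "AE x in M. x \<in> X" by eventually_elim (subst XA, blast)
  moreover have "X \<in> sets M" by (subst XA) (use A in blast)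
  ultimately show ?thesis using M.emeasure_eq_1_AE by blast
qed

lemma limit_inv_meas: "M \<in> inv_meas X"
  using M limit_invariant limit_support by (simp add: inv_meas_def)

text \<open>The code length of a word is a sum of a function of \<open>k + 1\<close> consecutive
  letters along its orbit; averaged over all words it becomes an expectation under
  \<open>P n\<close>, which involves finitely many cylinders and converges.\<close>

lemma growth_le_cross_entropy:
  fixes q :: "bool list \<Rightarrow> real"
  assumes growth: "\<And>n. real (s n) * c \<le> log 2 (real (card (words X (s n))))"
    and q: "\<And>v. 0 < q v" "\<And>v. length v = Suc k \<Longrightarrow> q v \<le> 1"
    and sum: "\<And>v. length v = k \<Longrightarrow> (\<Sum>a\<in>UNIV. q (v @ [a])) \<le> 1"
  shows "c \<le> (\<Sum>u\<in>wordsn (Suc k). word_prob M u * - log 2 (q u))"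
proof -
  let ?W = "\<lambda>n. words X (s n)" and ?x = "\<lambda>n w j i. \<rho> (s n) w (i + int j)"
  define \<phi> where "\<phi> u = - log 2 (q u)" for u
  have \<phi>: "0 \<le> \<phi> u" if "length u = Suc k" for u
    using q(1)[of u] q(2)[OF that] by (simp add: \<phi>_def)
  have le: "c \<le> real k * (1 / real (s n))
      + (\<Sum>u\<in>wordsn (Suc k). measure_pmf.prob (P n) (cyl u) * \<phi> u)" for n
  proof -
    have card: "real (card (?W n)) > 0"
      using finite_words words_nonempty by (simp add: card_gt_0_iff)
    have letters: "take (Suc k) (drop j w) = word (Suc k) (?x n w j)"
      if "w \<in> ?W n" "j < s n - k" for w j
    proof -
      have "take (Suc k) (drop j (word (s n) (\<rho> (s n) w))) = word (Suc k) (?x n w j)"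
        using that(2) by (intro nth_equalityI) (auto simp: word_def add_ac simp del: upt_Suc)
      then show ?thesis using \<rho>[OF that(1)] by simp
    qed
    have "(\<Sum>w\<in>?W n. \<Sum>j<s n - k. \<phi> (take (Suc k) (drop j w)))
        = (\<Sum>w\<in>?W n. \<Sum>j<s n - k. \<phi> (word (Suc k) (?x n w j)))"
      by (intro sum.cong refl) (simp add: letters)
    \<comment> \<open>The last windows run past the word into the rest of the chosen point of
      \<open>X\<close>. Adding them is harmless as \<phi> \<ge> 0, for which \<open>q\<close> was
      assumed at most 1 on words of length \<open>Suc k\<close>.\<close>
    also have "\<dots> \<le> (\<Sum>w\<in>?W n. \<Sum>j<s n. \<phi> (word (Suc k) (?x n w j)))"
      by (intro sum_mono sum_mono2) (auto simp: \<phi>)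
    also have "\<dots> = (\<Sum>w\<in>?W n. \<Sum>j<s n. \<Sum>u\<in>wordsn (Suc k). of_bool (?x n w j \<in> cyl u) * \<phi> u)"
    proof (intro sum.cong refl)
      fix w j
      have "(\<Sum>u\<in>wordsn (Suc k). of_bool (?x n w j \<in> cyl u) * \<phi> u)
          = (\<Sum>u\<in>wordsn (Suc k). of_bool (word (Suc k) (?x n w j) = u) * \<phi> u)"
        by (intro sum.cong refl) (simp add: in_cyl_iff)
      also have "\<dots> = \<phi> (word (Suc k) (?x n w j))" by (rule sum_of_bool_word) simp
      finally show "\<phi> (word (Suc k) (?x n w j))
          = (\<Sum>u\<in>wordsn (Suc k). of_bool (?x n w j \<in> cyl u) * \<phi> u)" by simp
    qed
    also have "\<dots> = (\<Sum>u\<in>wordsn (Suc k). (\<Sum>w\<in>?W n. \<Sum>j<s n. of_bool (?x n w j \<in> cyl u)) * \<phi> u)"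
      unfolding sum_distrib_right
      by (rule trans[OF sum.cong[OF refl sum.swap] sum.swap])
    also have "\<dots> = (\<Sum>u\<in>wordsn (Suc k). (measure_pmf.prob (P n) (cyl u) * (real (card (?W n)) * real (s n))) * \<phi> u)"
    proof -
      have "(\<Sum>w\<in>?W n. \<Sum>j<s n. of_bool (?x n w j \<in> cyl u))
          = measure_pmf.prob (P n) (cyl u) * (real (card (?W n)) * real (s n))" for u
        using card s_pos[of n] prob_P[of n "\<lambda>x. x \<in> cyl u"]
        by (simp only: Collect_mem_eq) simp
      then show ?thesis by simp
    qed
    also have "\<dots> = real (card (?W n)) * (real (s n) * (\<Sum>u\<in>wordsn (Suc k). measure_pmf.prob (P n) (cyl u) * \<phi> u))"
      by (simp add: sum_distrib_left mult_ac)
    finally have "(\<Sum>w\<in>?W n. \<Sum>j<s n - k. \<phi> (take (Suc k) (drop j w))) / real (card (?W n))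
        \<le> real (s n) * (\<Sum>u\<in>wordsn (Suc k). measure_pmf.prob (P n) (cyl u) * \<phi> u)"
      using card by (simp add: field_simps)
    moreover have "log 2 (real (card (?W n)))
      \<le> real k + (\<Sum>w\<in>?W n. \<Sum>j<s n - k. \<phi> (take (Suc k) (drop j w))) / real (card (?W n))"
      unfolding \<phi>_def
      by (rule log_card_le_markov) (auto simp: words_eq X q(1) sum)
    ultimately have "real (s n) * c \<le> real k
        + real (s n) * (\<Sum>u\<in>wordsn (Suc k). measure_pmf.prob (P n) (cyl u) * \<phi> u)"
      using growth[of n] by linarith
    then show ?thesis using s_pos[of n] by (simp add: field_simps)
  qed
  have "(\<lambda>n. measure_pmf.prob (P n) (cyl u)) \<longlonglongrightarrow> word_prob M u" for u
    unfolding word_prob_def cyl_box by (rule lim) simp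
  then have "(\<lambda>n. real k * (1 / real (s n)) + (\<Sum>u\<in>wordsn (Suc k). measure_pmf.prob (P n) (cyl u) * \<phi> u))
      \<longlonglongrightarrow> real k * 0 + (\<Sum>u\<in>wordsn (Suc k). word_prob M u * \<phi> u)"
    by (intro tendsto_add tendsto_mult tendsto_const s_inverse_lim tendsto_sum)
  then have "c \<le> real k * 0 + (\<Sum>u\<in>wordsn (Suc k). word_prob M u * \<phi> u)"
    by (rule LIMSEQ_le_const) (use le in blast)
  then show ?thesis by (simp add: \<phi>_def)
qed

text \<open>With the conditional probabilities of \<open>M\<close> as \<open>q\<close>, the cross
  entropy is the increment from H_k to H_(k+1). As every increment is at least \<open>c\<close>,
  summation gives n c \<le> H_n.\<close>

lemma growth_le_ent:
  assumes growth: "\<And>n. real (s n) * c \<le> log 2 (real (card (words X (s n))))"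
  shows "c \<le> ent M"
proof -
  interpret stationary "word_prob M"
    by (rule stationary_word_prob[OF limit_inv_meas])
  let ?p = "word_prob M"
  have le_butlast: "?p u \<le> ?p (butlast u)" if "u \<noteq> []" for u
  proof -
    have "?p (butlast u @ [last u]) \<le> (\<Sum>a\<in>UNIV. ?p (butlast u @ [a]))"
      by (rule member_le_sum) (auto simp: nonneg)
    then show ?thesis using that by (simp add: snoc)
  qed
  have incr: "c \<le> word_entropy ?p (Suc k) - word_entropy ?p k" for k
  proof -
    text \<open>The transition probabilities of the order-\<open>k\<close> Markov approximation of \<open>M\<close>, smoothed to be positive.\<close>
    define q where "q e u = (?p u + e) / (?p (butlast u) + 2 * e)" for e u
    have le: "c \<le> (\<Sum>u\<in>wordsn (Suc k). ?p u * - log 2 (q e u))" if e: "e > 0" for e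
    proof (rule growth_le_cross_entropy[OF growth])
      show "0 < q e v" for v
        unfolding q_def using nonneg[of v] nonneg[of "butlast v"] e
        by (intro divide_pos_pos) linarith+
      show "q e v \<le> 1" if "length v = Suc k" for v
      proof -
        have "v \<noteq> []" using that by auto
        from le_butlast[OF this] show ?thesis
          unfolding q_def using nonneg[of "butlast v"] e by (simp add: divide_le_eq_1)
      qed
      fix v :: "bool list"
      \<comment> \<open>The \<open>2 * e\<close> in the denominator matches one \<open>e\<close> for
        each of the two letters.\<close>
      have "(\<Sum>a\<in>UNIV. q e (v @ [a])) = ((\<Sum>a\<in>UNIV. ?p (v @ [a])) + 2 * e) / (?p v + 2 * e)"
        by (simp add: q_def UNIV_bool add_divide_distrib)
      also have "\<dots> \<le> 1" using nonneg[of v] e by (simp add: snoc)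
      finally show "(\<Sum>a\<in>UNIV. q e (v @ [a])) \<le> 1" .
    qed
    have e0: "(\<lambda>n. inverse (real (Suc n))) \<longlonglongrightarrow> 0" by (rule LIMSEQ_inverse_real_of_nat)
    \<comment> \<open>The smoothing is removed term by term: a word of probability 0 contributes 0
      throughout, and for any other word the prefix is positive too, so the logarithm is continuous
      there.\<close>
    have "(\<lambda>n. ?p u * - log 2 (q (inverse (real (Suc n))) u))
        \<longlonglongrightarrow> ?p u * - log 2 (?p u) + ?p u * log 2 (?p (butlast u))" if u: "u \<in> wordsn (Suc k)" for u
    proof (cases "?p u = 0")
      case False
      then have pos: "?p u > 0" using nonneg[of u] by simp
      then have pos': "?p (butlast u) > 0" using le_butlast[of u] u by force
      have "(\<lambda>n. ?p u * - log 2 (q (inverse (real (Suc n))) u)) \<longlonglongrightarrow> ?p u * - log 2 (q 0 u)"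
        unfolding q_def using pos pos'
        by (intro tendsto_intros e0) auto
      moreover have "?p u * - log 2 (q 0 u) = ?p u * - log 2 (?p u) + ?p u * log 2 (?p (butlast u))"
        using pos pos' by (simp add: q_def log_divide algebra_simps)
      ultimately show ?thesis by simp
    qed simp
    then have "(\<lambda>n. \<Sum>u\<in>wordsn (Suc k). ?p u * - log 2 (q (inverse (real (Suc n))) u))
        \<longlonglongrightarrow> (\<Sum>u\<in>wordsn (Suc k). ?p u * - log 2 (?p u) + ?p u * log 2 (?p (butlast u)))"
      by (rule tendsto_sum)
    then have "c \<le> (\<Sum>u\<in>wordsn (Suc k). ?p u * - log 2 (?p u) + ?p u * log 2 (?p (butlast u)))"
      by (rule LIMSEQ_le_const) (use le in auto)
    also have "\<dots> = word_entropy ?p (Suc k) + (\<Sum>u\<in>wordsn (Suc k). ?p u * log 2 (?p (butlast u)))"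
      by (simp add: sum.distrib word_entropy_def sum_negf sum_subtractf)
    also have "(\<Sum>u\<in>wordsn (Suc k). ?p u * log 2 (?p (butlast u))) = - word_entropy ?p k"
      by (simp add: sum_wordsn_snoc sum_distrib_right[symmetric] snoc word_entropy_def)
    finally show ?thesis by simp
  qed
  have "real n * c \<le> word_entropy ?p n" for n
  proof (induction n)
    case 0
    show ?case by (simp add: word_entropy_def nil)
  next
    case (Suc n)
    then show ?case using incr[of n] by (simp add: algebra_simps)
  qed
  then have "c \<le> word_entropy ?p n / real n" if "1 \<le> n" for n
    using that by (simp add: field_simps)
  then show ?thesis
    by (intro LIMSEQ_le_const[OF ent_limit(1)[OF limit_inv_meas]]) blast
qed

end

text \<open>Infinitely many lengths suffice: they contain a further subsequence along which the
  empirical measures converge, and the limit is the measure sought.\<close>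

lemma exists_large_entropy:
  assumes X: "subshift X" "X \<noteq> {}"
    and inf: "infinite {n. real n * c \<le> log 2 (real (card (words X n)))}" (is "infinite ?S")
  shows "\<exists>\<mu>\<in>inv_meas X. c \<le> ent \<mu>"
proof -
  have "\<forall>n. \<exists>m. n < m \<and> m \<in> ?S"
    using inf by (simp add: infinite_nat_iff_unbounded)
  then obtain s where s: "\<And>n. n < s n" "\<And>n. s n \<in> ?S" by metis
  define \<rho> where "\<rho> n w = (SOME x. x \<in> X \<and> word n x = w)" for n w
  have \<rho>: "\<rho> n w \<in> X \<and> word n (\<rho> n w) = w" if w: "w \<in> words X n" for n w
  proof -
    obtain x where "x \<in> X \<and> word n x = w" using w by (auto simp: words_eq)
    from someI[of "\<lambda>x. x \<in> X \<and> word n x = w", OF this] show ?thesis unfolding \<rho>_def .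
  qed
  obtain r M where rM: "strict_mono (r :: nat \<Rightarrow> nat)" "sets M = sets Omega" "prob_space M"
    "\<And>J v. finite J \<Longrightarrow>
      (\<lambda>n. measure_pmf.prob (orbit_pmf (\<rho> (s (r n))) (words X (s (r n))) (s (r n))) {x. \<forall>i\<in>J. x i = v i})
        \<longlonglongrightarrow> measure M {x. \<forall>i\<in>J. x i = v i}"
    using config_measure_limit[of "\<lambda>n. orbit_pmf (\<rho> (s n)) (words X (s n)) (s n)"] by blast
  have sr: "n < s (r n)" for n
    using s(1)[of "r n"] seq_suble[OF rM(1), of n] by linarith
  have "M \<in> inv_meas X"
    by (rule limit_inv_meas[where s = "\<lambda>n. s (r n)", OF X \<rho> sr rM(2-4)])
  moreover have "c \<le> ent M"
    by (rule growth_le_ent[where s = "\<lambda>n. s (r n)", OF X \<rho> sr rM(2-4)]) (use s(2) in auto)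
  ultimately show ?thesis by blast
qed

theorem theorem5p1:
  fixes X :: "config set" and \<nu> :: "config measure"
  assumes base: "\<nu> \<in> inv_meas UNIV"
    and sub: "meas_subordinate X \<nu>"
    and zero: "ent \<nu> = 0"
  shows "htop X = measure \<nu> {x. x 0} \<and> intrinsically_ergodic X
         \<and> mme X (distr (\<nu> \<Otimes>\<^sub>M Bernoulli_half) Omega Mult)"
proof -
  let ?L = "\<nu> \<Otimes>\<^sub>M Bernoulli_half" and ?c = "measure \<nu> {x. x 0}"
  let ?\<mu> = "distr ?L Omega Mult"
  have X: "subshift X"
    and inv: "inv_meas X = {distr L Omega Mult | L. L \<in> inv_meas2 \<and> distr L Omega fst = \<nu>}"
    using sub by (simp_all add: meas_subordinate_def)
  have mem: "?\<mu> \<in> inv_meas X"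
    unfolding inv using product_inv_meas2[OF base] product_fst[OF base] by blast
  have upper: "ent \<mu> \<le> ?c" if "\<mu> \<in> inv_meas X" for \<mu>
    using that ent_Mult_le[OF _ _ zero] unfolding inv by blast
  have lower: "?c \<le> ent ?\<mu>"
  proof (rule LIMSEQ_le_const[OF ent_limit(1)[OF mem]], intro exI[of _ 1] allI impI)
    fix n :: nat assume "1 \<le> n"
    then show "?c \<le> word_entropy (word_prob ?\<mu>) n / real n"
      using product_entropy_ge[OF base, of n] by (simp add: field_simps)
  qed
  have max: "mme X ?\<mu>"
    unfolding mme_def using mem upper lower by (meson order_trans)
  have unique: "\<mu> = ?\<mu>" if "mme X \<mu>" for \<mu>
  proof -
    have \<mu>: "\<mu> \<in> inv_meas X" "?c \<le> ent \<mu>"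
      using that mem lower unfolding mme_def by (meson order_trans)+
    then obtain L where L: "\<mu> = distr L Omega Mult" "L \<in> inv_meas2" "distr L Omega fst = \<nu>"
      unfolding inv by blast
    \<comment> \<open>Maximality forces the kernel formula for \<open>L\<close>, and the product
      satisfies the same formula; z is a factor of the pair, so its law agrees as well.\<close>
    have "pair_prob L = pair_prob ?L"
      using maximal_pair_prob[OF L(2,3) zero] \<mu>(2) product_pair_prob[OF base] L(1) by (intro ext) simp
    then have "word_prob \<mu> = word_prob ?\<mu>"
      using factor_pair_prob(2)[OF L(2)] factor_pair_prob(2)[OF product_inv_meas2[OF base]] L(1) by simp
    then show ?thesis by (rule inv_meas_eqI[OF \<mu>(1) mem])
  qed
  have "X \<noteq> {}" using inv_measD(5)[OF mem] by auto
  have "(\<lambda>n. log 2 (real (card (words X n))) / real n) \<longlonglongrightarrow> ?c"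
  proof (rule order_tendstoI)
    fix a assume a: "a < ?c"
    show "\<forall>\<^sub>F n in sequentially. a < log 2 (real (card (words X n))) / real n"
      using eventually_gt_at_top[of 0]
    proof eventually_elim
      case (elim n)
      have "real n * a < real n * ?c" using a elim by simp
      also have "\<dots> \<le> log 2 (real (card (words X n)))"
        using product_entropy_ge[OF base, of n] entropy_le_words[OF mem, of n] by linarith
      finally show ?case using elim by (simp add: field_simps)
    qed
  next
    fix a assume a: "?c < a"
    \<comment> \<open>If the growth rate reached \<open>a\<close> infinitely often, some invariant
      measure on \<open>X\<close> would have entropy at least \<open>a\<close> > \<nu>(1). Excluding
      this for all but finitely many lengths gives convergence, which \<open>lim\<close> in
      \<open>htop\<close> requires.\<close>
    have "finite {n. real n * a \<le> log 2 (real (card (words X n)))}"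
    proof (rule ccontr)
      assume "infinite {n. real n * a \<le> log 2 (real (card (words X n)))}"
      from exists_large_entropy[OF X \<open>X \<noteq> {}\<close> this] show False
        using upper a by fastforce
    qed
    then obtain N where N: "\<And>n. real n * a \<le> log 2 (real (card (words X n))) \<Longrightarrow> n < N"
      by (auto simp: finite_nat_set_iff_bounded)
    show "\<forall>\<^sub>F n in sequentially. log 2 (real (card (words X n))) / real n < a"
      using eventually_gt_at_top[of 0] eventually_ge_at_top[of N]
    proof eventually_elim
      case (elim n)
      then have "log 2 (real (card (words X n))) < real n * a" using N[of n] by linarith
      then show ?case using elim by (simp add: field_simps)
    qed
  qed
  then have "htop X = ?c" unfolding htop_def by (rule limI)
  moreover have "intrinsically_ergodic X"
    unfolding intrinsically_ergodic_def using max unique by blast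
  ultimately show ?thesis using max by blast
qed

end
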